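(* Let $r,s$ be positive integers with $r+s\equiv 0\pmod 5$. Then $$2\varphi(q^r)\varphi(q^s)+T_5\big(\varphi(q^r)\varphi(q^s)\big)=4E(q^{2r})E(q^{2s})U(r,s)U(4r,4s),$$ $$2\varphi(q^r)\varphi(q^s)-T_5\big(\varphi(q^r)\varphi(q^s)\big)=4q^rE(q^{2r})E(q^{2s})U(r,4s)U(4r,s).$$
   Context: Let $|q|<1$, $(a;q)_\infty=\prod_{k\ge0}(1-aq^k)$, $(a;q)_n=\prod_{k=0}^{n-1}(1-aq^k)$. $G(q)=\sum_{n\ge0}\frac{q^{n^2}}{(q;q)_n}$, $H(q)=\sum_{n\ge0}\frac{q^{n(n+1)}}{(q;q)_n}$. For positive integers $r,s$, $$U(r,s)=\begin{cases} G(q^r)G(q^s)+q^{(s+r)/5}H(q^r)H(q^s) & \text{if } s+r\equiv0\pmod5,\\ H(q^r)G(q^s)-q^{(s-r)/5}G(q^r)H(q^s) & \text{if } s-r\equiv 0\pmod 5.\end{cases}$$ $\varphi(q)=\sum_{n=-\infty}^\infty q^{n^2}$, $E(q)=(q;q)_\infty$. For a series $\sum a(n)q^n$, $T_5\left(\sum a(n)q^n\right)=\sum\big(a(5n)+a(n/5)\big)q^n$ with $a(k)=0$ for non-integer $k$.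
   Formalization: The formal theorem also assumes that 5 does not divide r (hence not s); if 5 divides both, the two cases in the definition of U overlap and the identities fail, e.g. for r = s = 5 the coefficient of q in the first is 4 on the left and 0 on the right. *)

theory Defs
  imports "HOL-Complex_Analysis.Complex_Analysis" "HOL-Number_Theory.Cong"
begin

definition qpoch :: "complex \<Rightarrow> complex \<Rightarrow> nat \<Rightarrow> complex" where
  "qpoch a q n = (\<Prod>k<n. 1 - a * q ^ k)"

definition qpoch_inf :: "complex \<Rightarrow> complex \<Rightarrow> complex" where
  "qpoch_inf a q = (\<Prod>k. 1 - a * q ^ k)"

definition euler_E :: "complex \<Rightarrow> complex" where
  "euler_E q = qpoch_inf q q"

definition RR_G :: "complex \<Rightarrow> complex" where
  "RR_G q = (\<Sum>n. q ^ n\<^sup>2 / qpoch q q n)"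

definition RR_H :: "complex \<Rightarrow> complex" where
  "RR_H q = (\<Sum>n. q ^ (n * (n + 1)) / qpoch q q n)"

definition ramanujan_phi :: "complex \<Rightarrow> complex" where
  "ramanujan_phi q = (\<Sum>\<^sub>\<infinity>n::int. q powi n\<^sup>2)"

(* The exponent (s - r) / 5 of the second case may be negative, hence powi.
   The two cases overlap exactly when 5 divides both r and s; there U is ambiguous,
   and the order of the cases below carries no meaning. *)
definition RR_U :: "nat \<Rightarrow> nat \<Rightarrow> complex \<Rightarrow> complex" where
  "RR_U r s q =
     (if [s + r = 0] (mod 5) then
        RR_G (q ^ r) * RR_G (q ^ s) + q ^ ((s + r) div 5) * RR_H (q ^ r) * RR_H (q ^ s)
      else if [int s - int r = 0] (mod 5) then
        RR_H (q ^ r) * RR_G (q ^ s) - q powi ((int s - int r) div 5) * RR_G (q ^ r) * RR_H (q ^ s)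
      else undefined)"

definition T5_series :: "complex fps \<Rightarrow> complex fps" where
  "T5_series A = Abs_fps (\<lambda>n. fps_nth A (5 * n) + (if 5 dvd n then fps_nth A (n div 5) else 0))"

(* T5 on functions of q acts through the coefficients of the power series at 0. *)
definition T5 :: "(complex \<Rightarrow> complex) \<Rightarrow> complex \<Rightarrow> complex" where
  "T5 f q = eval_fps (T5_series (fps_expansion f 0)) q"

end

theory Submission
  imports Defs
begin

text \<open>
  Write \<open>E2 = E(q\<^sup>2)\<close>, \<open>G4 = G(q^4)\<close>, \<open>H4 = H(q^4)\<close>. The theorem is a bilinear consequence of the four
  identities of one variable
  \<open>E2 G G4 + q E2 H H4 = \<phi>(q)\<close>,
  \<open>E2 G G4 - q E2 H H4 = \<phi>(q^5)\<close>,
  \<open>E2 H G4 = \<Sum> q^(5n\<^sup>2 + 2n)\<close>,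
  \<open>E2 G H4 = \<Sum> q^(5n\<^sup>2 + 4n)\<close>,
  applied at \<open>q^r\<close> and \<open>q^s\<close>: the pairs \<open>(m, n)\<close> with \<open>5\<close> dividing \<open>r m\<^sup>2 + s n\<^sup>2\<close> are those with
  \<open>m \<equiv> \<plusminus>n\<close> modulo 5, and sorting them by residues expresses \<open>T\<^sub>5(\<phi>(q^r) \<phi>(q^s))\<close> through the three
  theta functions \<open>\<phi>(q^5)\<close>, \<open>\<Sum> q^(5n\<^sup>2 + 2n)\<close>, \<open>\<Sum> q^(5n\<^sup>2 + 4n)\<close> at \<open>q^r\<close> and \<open>q^s\<close>.

  The last two identities follow by comparing the products given by the Rogers-Ramanujan identities
  and the Jacobi triple product. The second one is then equivalent to a Pluecker relation between
  values of theta functions at three points. For the first one, sorting the Gaussian integers modulo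
  \<open>2 - i\<close> gives \<open>\<phi>(q)\<^sup>2 - \<phi>(q^5)\<^sup>2 = 4 (E2 G G4) (q E2 H H4)\<close>; together with the second identity this
  determines \<open>E2 G G4 + q E2 H H4\<close> up to sign, and analytic continuation from \<open>q = 0\<close> fixes the sign.
\<close>

section \<open>Finite q-series identities\<close>

text \<open>The convention \<open>1 / (q; q)\<^sub>m = 0\<close> for \<open>m < 0\<close> makes the recurrence
  \<open>inv_qfac_step\<close> valid for all integers, so that boundary terms of sums vanish by themselves.\<close>
definition inv_qfac :: "complex \<Rightarrow> int \<Rightarrow> complex" where
  "inv_qfac q m = (if m < 0 then 0 else 1 / qpoch q q (nat m))"

lemma one_minus_power_nonzero:
  fixes q :: complex
  assumes "norm q < 1" "n > 0"
  shows "1 - q ^ n \<noteq> 0"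
proof
  assume "1 - q ^ n = 0"
  hence "norm q ^ n = 1"
    by (metis norm_one norm_power right_minus_eq)
  thus False using assms
    by (metis norm_ge_zero power_less_one_iff less_irrefl)
qed

lemma qpoch_self_nonzero: "norm q < 1 \<Longrightarrow> qpoch q q n \<noteq> 0"
  using one_minus_power_nonzero[of q "Suc _"] by (auto simp: qpoch_def)

lemma qpoch_0 [simp]: "qpoch a q 0 = 1"
  by (simp add: qpoch_def)

lemma qpoch_Suc: "qpoch a q (Suc n) = qpoch a q n * (1 - a * q ^ n)"
  by (simp add: qpoch_def)

lemma qpoch_Suc': "qpoch a q (Suc n) = (1 - a) * qpoch (a * q) q n"
  unfolding qpoch_def by (subst prod.lessThan_Suc_shift) (simp add: mult_ac)

lemma qpoch_one: "qpoch 1 q n = (if n = 0 then 1 else 0)"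
  by (cases n) (simp_all add: qpoch_Suc')

lemma inv_qfac_neg [simp]: "m < 0 \<Longrightarrow> inv_qfac q m = 0"
  by (simp add: inv_qfac_def)

lemma inv_qfac_0 [simp]: "inv_qfac q 0 = 1"
  by (simp add: inv_qfac_def)

lemma inv_qfac_of_nat: "inv_qfac q (int n) = 1 / qpoch q q n"
  by (simp add: inv_qfac_def)

lemma inv_qfac_step:
  assumes "norm q < 1"
  shows "(1 - q powi m) * inv_qfac q m = inv_qfac q (m - 1)"
proof (cases "m > 0")
  case True
  then obtain k where k: "m = int (Suc k)" by (metis gr0_implies_Suc zero_less_imp_eq_int)
  have "q powi m = q ^ Suc k" unfolding k by (rule power_int_of_nat)
  moreover have "inv_qfac q (m - 1) = 1 / qpoch q q k"
    unfolding k using inv_qfac_of_nat[of q k] by simp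
  moreover have "1 - q ^ Suc k \<noteq> 0" using one_minus_power_nonzero[of q "Suc k"] assms by simp
  ultimately show ?thesis unfolding k inv_qfac_of_nat qpoch_Suc
    using qpoch_self_nonzero[OF assms, of k] by (simp add: field_simps)
next
  case False
  thus ?thesis by (cases "m = 0") auto
qed

definition tri :: "int \<Rightarrow> int" where "tri j = j * (j - 1) div 2"

lemma two_tri: "2 * tri j = j * (j - 1)"
  by (simp add: tri_def)

lemma tri_plus1: "tri (j + 1) = tri j + j"
  using two_tri[of j] two_tri[of "j + 1"] by (simp add: algebra_simps)

lemma tri_0 [simp]: "tri 0 = 0" by (simp add: tri_def)

text \<open>Cauchy's q-binomial theorem, divided by \<open>(q; q)_n\<close>. The q-Pascal split
  \<open>1 - q^(n+1) = (1 - q^j) + q^j (1 - q^(n+1-j))\<close> produces two copies of the sum for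
  \<open>n\<close> at \<open>w q\<close>, one of them shifted and carrying a factor
  \<open>w\<close>; hence \<open>w\<close> varies in the induction.\<close>

lemma q_binomial_theorem:
  fixes q w :: complex
  assumes q: "norm q < 1" "q \<noteq> 0" and "w \<noteq> 0"
  shows "(\<Sum>j=0..int n. w powi j * q powi tri j * inv_qfac q (int n - j) * inv_qfac q j)
           = qpoch (-w) q n * inv_qfac q (int n)"
  using \<open>w \<noteq> 0\<close>
proof (induction n arbitrary: w)
  case 0
  thus ?case by simp
next
  case (Suc n)
  let ?N = "int n + 1"
  let ?t = "\<lambda>w j. w powi j * q powi tri j"
  let ?B = "\<lambda>n w. (\<Sum>j=0..n. ?t w j * inv_qfac q (n - j) * inv_qfac q j)"
  have nz: "1 - q powi ?N \<noteq> 0"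
    using one_minus_power_nonzero[of q "Suc n"] q power_int_of_nat[of q "Suc n"]
    by (simp add: add.commute)
  have "(1 - q powi ?N) * ?B ?N w =
     (\<Sum>j=0..?N. ?t w j * inv_qfac q (?N - j) * inv_qfac q (j - 1)) +
     (\<Sum>j=0..?N. ?t (w*q) j * inv_qfac q (int n - j) * inv_qfac q j)"
    unfolding sum_distrib_left sum.distrib[symmetric]
  proof (rule sum.cong[OF refl])
    fix j
    have 1: "inv_qfac q (j - 1) = (1 - q powi j) * inv_qfac q j"
      using inv_qfac_step[OF q(1), of j] by simp
    have 2: "inv_qfac q (int n - j) = (1 - q powi (?N - j)) * inv_qfac q (?N - j)"
      using inv_qfac_step[OF q(1), of "?N - j"] by (simp add: algebra_simps)
    have 3: "q powi ?N = q powi j * q powi (?N - j)"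
      using q by (simp flip: power_int_add)
    show "(1 - q powi ?N) * (?t w j * inv_qfac q (?N - j) * inv_qfac q j)
      = ?t w j * inv_qfac q (?N - j) * inv_qfac q (j - 1) +
        ?t (w*q) j * inv_qfac q (int n - j) * inv_qfac q j"
      unfolding 1 2 3 power_int_mult_distrib by (simp add: algebra_simps)
  qed
  also have "(\<Sum>j=0..?N. ?t w j * inv_qfac q (?N - j) * inv_qfac q (j - 1))
      = (\<Sum>j=-1..int n. ?t w (j + 1) * inv_qfac q (int n - j) * inv_qfac q j)"
    by (rule sum.reindex_bij_witness[of _ "\<lambda>j. j + 1" "\<lambda>j. j - 1"]) (auto simp: algebra_simps)
  \<comment> \<open>The shift creates a term at \<open>j = -1\<close>, which
    \<open>inv_qfac q (-1) = 0\<close> removes.\<close>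
  also have "\<dots> = (\<Sum>j=0..int n. ?t w (j + 1) * inv_qfac q (int n - j) * inv_qfac q j)"
    by (rule sum.mono_neutral_right) auto
  also have "\<dots> = w * ?B (int n) (w * q)"
    unfolding sum_distrib_left using Suc.prems q
    by (intro sum.cong refl) (simp add: tri_plus1 power_int_add power_int_mult_distrib algebra_simps)
  also have "(\<Sum>j=0..?N. ?t (w*q) j * inv_qfac q (int n - j) * inv_qfac q j) = ?B (int n) (w * q)"
    by (rule sum.mono_neutral_right) auto
  finally have "(1 - q powi ?N) * ?B ?N w = (1 + w) * ?B (int n) (w * q)"
    by (simp add: algebra_simps)
  also have "?B (int n) (w * q) = qpoch (-(w * q)) q n * inv_qfac q (int n)"
    by (rule Suc.IH) (use Suc.prems q in auto)
  also have "inv_qfac q (int n) = (1 - q powi ?N) * inv_qfac q ?N"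
    using inv_qfac_step[OF q(1), of ?N] by simp
  finally have "(1 - q powi ?N) * ?B ?N w = (1 - q powi ?N) * (qpoch (-w) q (Suc n) * inv_qfac q ?N)"
    by (simp add: qpoch_Suc' algebra_simps)
  hence "?B ?N w = qpoch (-w) q (Suc n) * inv_qfac q ?N" using nz by simp
  thus ?case by (simp add: add.commute)
qed

text \<open>Shifting \<open>j\<close> by one trades \<open>m\<close> for \<open>n\<close> and
  \<open>w\<close> for \<open>w / q\<close>, so the induction on \<open>m\<close> starts from the
  q-binomial theorem. On the product side \<open>(q / w) (1 + w / q) = 1 + q / w\<close> moves one
  factor between the two products.\<close>

lemma finite_jacobi_triple_product:
  fixes q w :: complex
  assumes q: "norm q < 1" "q \<noteq> 0" and "w \<noteq> 0"
  shows "(\<Sum>j=-int m..int n. w powi j * q powi tri j * inv_qfac q (int n - j) * inv_qfac q (int m + j))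
           = qpoch (-w) q n * qpoch (-(q / w)) q m * inv_qfac q (int n + int m)"
  using \<open>w \<noteq> 0\<close>
proof (induction m arbitrary: n w)
  case 0
  thus ?case using q_binomial_theorem[OF q, of w n] by simp
next
  case (Suc m)
  have "(\<Sum>j=-int (Suc m)..int n. w powi j * q powi tri j * inv_qfac q (int n - j) * inv_qfac q (int (Suc m) + j))
    = (\<Sum>j=-int m..int (Suc n). (q/w) * ((w/q) powi j * q powi tri j * inv_qfac q (int (Suc n) - j) * inv_qfac q (int m + j)))"
  proof (rule sum.reindex_bij_witness[of _ "\<lambda>j. j - 1" "\<lambda>j. j + 1"], goal_cases)
    case (5 j)
    show ?case using q Suc.prems
      by (simp add: tri_plus1 tri_plus1[of j, unfolded add.commute[of j]] power_int_add power_int_divide_distrib field_simps)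
  qed auto
  also have "\<dots> = (q/w) * (qpoch (-(w/q)) q (Suc n) * qpoch (-(q / (w/q))) q m * inv_qfac q (int (Suc n) + int m))"
    unfolding sum_distrib_left[symmetric] by (subst Suc.IH) (use Suc.prems q in auto)
  also have "\<dots> = qpoch (-w) q n * qpoch (-(q / w)) q (Suc m) * inv_qfac q (int n + int (Suc m))"
    using Suc.prems q by (simp add: qpoch_Suc' field_simps)
  finally show ?case .
qed

text \<open>Induction on \<open>N - a\<close>:
  \<open>1 - q^(N-a) = (1 - q^(N-s)) + q^(N-s) (1 - q^(s-a))\<close> splits the sum into one with
  \<open>N\<close> lowered and one with \<open>a\<close> raised. The order of \<open>a\<close> and
  \<open>b\<close> is arbitrary, since terms with \<open>s < b\<close> vanish.\<close>

lemma q_chu_vandermonde: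
  fixes q :: complex
  assumes q: "norm q < 1" "q \<noteq> 0"
  shows "(\<Sum>s=a..N. q powi ((s - a) * (s - b)) * inv_qfac q (N - s) * inv_qfac q (s - a) * inv_qfac q (s - b))
           = inv_qfac q (N - a) * inv_qfac q (N - b)"
proof -
  have "N - a = int n \<Longrightarrow> ?thesis" for n
  proof (induction n arbitrary: a N)
    case 0
    hence "N = a" by simp
    thus ?case by simp
  next
    case (Suc n)
    let ?x = "\<lambda>a s. q powi ((s - a) * (s - b))"
    have IH: "(\<Sum>s=a..N-1. ?x a s * inv_qfac q (N - 1 - s) * inv_qfac q (s - a) * inv_qfac q (s - b))
           = inv_qfac q (N - 1 - a) * inv_qfac q (N - 1 - b)"
      "(\<Sum>s=a+1..N. ?x (a+1) s * inv_qfac q (N - s) * inv_qfac q (s - (a+1)) * inv_qfac q (s - b))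
           = inv_qfac q (N - (a+1)) * inv_qfac q (N - b)"
      by (rule Suc.IH; use Suc.prems in simp)+
    have nz: "1 - q powi (N - a) \<noteq> 0"
      using one_minus_power_nonzero[of q "Suc n"] q power_int_of_nat[of q "Suc n"] Suc.prems
      by simp
    have "(1 - q powi (N - a)) * (\<Sum>s=a..N. ?x a s * inv_qfac q (N - s) * inv_qfac q (s - a) * inv_qfac q (s - b))
      = (\<Sum>s=a..N. ?x a s * inv_qfac q (N - 1 - s) * inv_qfac q (s - a) * inv_qfac q (s - b))
      + (\<Sum>s=a..N. q powi (N - b) * (?x (a+1) s * inv_qfac q (N - s) * inv_qfac q (s - (a+1)) * inv_qfac q (s - b)))"
      unfolding sum_distrib_left sum.distrib[symmetric]
    proof (rule sum.cong[OF refl])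
      fix s
      have 1: "inv_qfac q (N - 1 - s) = (1 - q powi (N - s)) * inv_qfac q (N - s)"
        using inv_qfac_step[OF q(1), of "N - s"] by (simp add: algebra_simps)
      have 2: "inv_qfac q (s - (a + 1)) = (1 - q powi (s - a)) * inv_qfac q (s - a)"
        using inv_qfac_step[OF q(1), of "s - a"] by (simp add: algebra_simps)
      have 3: "q powi (N - a) = q powi (N - s) * q powi (s - a)"
        using q by (simp flip: power_int_add)
      \<comment> \<open>This balance of exponents lets the factor \<open>q^(N-b)\<close>, free of
        \<open>s\<close>, be taken out of the second part.\<close>
      have "(N - b) + (s - (a + 1)) * (s - b) = (N - s) + (s - a) * (s - b)"
        by (simp add: algebra_simps)
      hence 4: "q powi (N - b) * ?x (a+1) s = q powi (N - s) * ?x a s"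
        using q by (metis power_int_add)
      have "q powi (N - b) * (?x (a+1) s * inv_qfac q (N - s) * inv_qfac q (s - (a+1)) * inv_qfac q (s - b))
        = (q powi (N - b) * ?x (a+1) s) * (inv_qfac q (N - s) * inv_qfac q (s - (a+1)) * inv_qfac q (s - b))"
        by (simp add: mult_ac)
      thus "(1 - q powi (N - a)) * (?x a s * inv_qfac q (N - s) * inv_qfac q (s - a) * inv_qfac q (s - b))
        = ?x a s * inv_qfac q (N - 1 - s) * inv_qfac q (s - a) * inv_qfac q (s - b)
        + q powi (N - b) * (?x (a+1) s * inv_qfac q (N - s) * inv_qfac q (s - (a+1)) * inv_qfac q (s - b))"
        unfolding 4 1 2 3 by (simp add: algebra_simps)
    qed
    also have "(\<Sum>s=a..N. ?x a s * inv_qfac q (N - 1 - s) * inv_qfac q (s - a) * inv_qfac q (s - b))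
      = (\<Sum>s=a..N-1. ?x a s * inv_qfac q (N - 1 - s) * inv_qfac q (s - a) * inv_qfac q (s - b))"
      by (rule sum.mono_neutral_right) auto
    also have "(\<Sum>s=a..N. q powi (N - b) * (?x (a+1) s * inv_qfac q (N - s) * inv_qfac q (s - (a+1)) * inv_qfac q (s - b)))
      = q powi (N - b) * (\<Sum>s=a+1..N. ?x (a+1) s * inv_qfac q (N - s) * inv_qfac q (s - (a+1)) * inv_qfac q (s - b))"
      unfolding sum_distrib_left[symmetric] by (intro arg_cong2[of _ _ _ _ "(*)"] refl sum.mono_neutral_right) auto
    also note IH(1)
    also note IH(2)
    also have "inv_qfac q (N - 1 - a) * inv_qfac q (N - 1 - b) + q powi (N - b) * (inv_qfac q (N - (a + 1)) * inv_qfac q (N - b))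
      = (1 - q powi (N - a)) * (inv_qfac q (N - a) * inv_qfac q (N - b))"
    proof -
      have 1: "inv_qfac q (N - 1 - b) = (1 - q powi (N - b)) * inv_qfac q (N - b)"
        using inv_qfac_step[OF q(1), of "N - b"] by (simp add: algebra_simps)
      have 2: "inv_qfac q (N - 1 - a) = (1 - q powi (N - a)) * inv_qfac q (N - a)"
        using inv_qfac_step[OF q(1), of "N - a"] by (simp add: algebra_simps)
      have 3: "inv_qfac q (N - (a + 1)) = inv_qfac q (N - 1 - a)" by (simp add: algebra_simps)
      show ?thesis unfolding 3 1 2 by (simp add: algebra_simps)
    qed
    finally show ?case using nz by simp
  qed
  \<comment> \<open>For \<open>N < a\<close> the sum is empty and \<open>inv_qfac q (N - a)\<close>
    is zero.\<close>
  moreover have ?thesis if "N < a" using that by simp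
  ultimately show ?thesis
    by (metis diff_ge_0_iff_ge linorder_not_le nonneg_int_cases)
qed

section \<open>The Jacobi triple product\<close>

lemma qpoch_convergent_prod:
  fixes a q :: complex
  assumes "norm q < 1"
  shows "convergent_prod (\<lambda>k. 1 - a * q ^ k)"
proof -
  have "summable (\<lambda>k. norm (a * q ^ k))"
    using assms by (simp add: norm_mult norm_power summable_geometric summable_mult)
  thus ?thesis
    by (intro abs_convergent_prod_imp_convergent_prod summable_imp_abs_convergent_prod) simp
qed

lemma qpoch_LIMSEQ:
  assumes "norm q < 1"
  shows "(\<lambda>n. qpoch a q n) \<longlonglongrightarrow> qpoch_inf a q"
proof -
  have "(\<lambda>n. qpoch a q (Suc n)) \<longlonglongrightarrow> qpoch_inf a q"
    using convergent_prod_LIMSEQ[OF qpoch_convergent_prod[OF assms]]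
    by (simp add: qpoch_def qpoch_inf_def lessThan_Suc_atMost)
  thus ?thesis by (rule LIMSEQ_imp_Suc)
qed

lemma qpoch_inf_nonzero:
  assumes "norm q < 1" "norm a < 1"
  shows "qpoch_inf a q \<noteq> 0"
  unfolding qpoch_inf_def
proof (rule prodinf_nonzero[OF qpoch_convergent_prod[OF assms(1)]])
  fix k
  have "norm (a * q ^ k) \<le> norm a * 1"
    unfolding norm_mult norm_power using assms by (intro mult_left_mono power_le_one) auto
  hence "norm (a * q ^ k) < 1" using assms by simp
  thus "1 - a * q ^ k \<noteq> 0" by (metis norm_one less_irrefl right_minus_eq)
qed

lemma euler_E_nonzero: "norm q < 1 \<Longrightarrow> euler_E q \<noteq> 0"
  unfolding euler_E_def by (rule qpoch_inf_nonzero)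

lemma filterlim_nat_offset: "filterlim (\<lambda>N. nat (int N + j)) sequentially sequentially"
  unfolding filterlim_at_top
proof
  fix Z
  show "\<forall>\<^sub>F N in sequentially. Z \<le> nat (int N + j)"
    using eventually_ge_at_top[of "Z + nat \<bar>j\<bar>"] by eventually_elim linarith
qed

lemma inv_qfac_LIMSEQ:
  assumes "norm q < 1"
  shows "(\<lambda>N. inv_qfac q (int N + j)) \<longlonglongrightarrow> 1 / euler_E q"
proof -
  have "(\<lambda>N. 1 / qpoch q q (nat (int N + j))) \<longlonglongrightarrow> 1 / euler_E q"
    using filterlim_compose[OF qpoch_LIMSEQ[OF assms, of q] filterlim_nat_offset[of j]]
      euler_E_nonzero[OF assms]
    by (intro tendsto_intros) (auto simp: euler_E_def)
  moreover have "\<forall>\<^sub>F N in sequentially. 1 / qpoch q q (nat (int N + j)) = inv_qfac q (int N + j)"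
    using eventually_ge_at_top[of "nat \<bar>j\<bar>"] by eventually_elim (auto simp: inv_qfac_def)
  ultimately show ?thesis by (rule Lim_transform_eventually)
qed

lemma inv_qfac_bounded:
  assumes "norm q < 1"
  obtains C where "C > 0" "\<And>m. norm (inv_qfac q m) \<le> C"
proof -
  have "Bseq (\<lambda>N. inv_qfac q (int N))"
    using inv_qfac_LIMSEQ[OF assms, of 0] by (intro convergent_imp_Bseq) (auto simp: convergent_def)
  then obtain C where C: "C > 0" "\<And>N. norm (inv_qfac q (int N)) \<le> C"
    unfolding Bseq_def by blast
  have "norm (inv_qfac q m) \<le> C" for m
    using C(1) C(2)[of "nat m"] by (cases "m < 0") auto
  thus ?thesis using C(1) that by blast
qed

text \<open>Tannery's theorem: the summable majorant makes the finite partial sums converge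
  uniformly in \<open>n\<close>, which permits exchanging the two limits.\<close>

lemma infsum_dominated_LIMSEQ:
  fixes f :: "nat \<Rightarrow> 'a \<Rightarrow> 'b :: banach"
  assumes lim: "\<And>x. (\<lambda>n. f n x) \<longlonglongrightarrow> g x"
    and bound: "\<And>n x. norm (f n x) \<le> M x" and M: "M summable_on UNIV"
  shows "(\<lambda>n. \<Sum>\<^sub>\<infinity>x. f n x) \<longlonglongrightarrow> (\<Sum>\<^sub>\<infinity>x. g x)"
proof (rule swap_uniform_limit')
  show "\<forall>\<^sub>F X in finite_subsets_at_top UNIV. (\<lambda>n. \<Sum>x\<in>X. f n x) \<longlonglongrightarrow> (\<Sum>x\<in>X. g x)"
    by (intro always_eventually allI tendsto_sum lim)
  have "norm (g x) \<le> M x" for x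
    by (rule tendsto_upperbound[OF tendsto_norm[OF lim]]) (simp_all add: bound)
  hence "(\<lambda>x. norm (g x)) summable_on UNIV"
    by (rule Infinite_Sum.abs_summable_on_comparison_test'[OF M])
  thus "(sum g \<longlongrightarrow> infsum g UNIV) (finite_subsets_at_top UNIV)"
    by (rule infsum_tendsto[OF Infinite_Sum.abs_summable_summable])
  show "uniform_limit UNIV (\<lambda>X n. \<Sum>x\<in>X. f n x) (\<lambda>n. \<Sum>\<^sub>\<infinity>x. f n x) (finite_subsets_at_top UNIV)"
    by (rule Weierstrass_m_test_general[OF bound M])
qed auto

text \<open>For fixed \<open>j\<close> both reciprocal factorials tend to \<open>1 / E(q)\<close>,
  and they are bounded independently of \<open>j\<close> and \<open>N\<close>, so Tannery's theorem
  applies. Since they vanish outside the finite range, the finite sum is a sum over all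
  integers.\<close>

lemma bilateral_sum_LIMSEQ:
  assumes q: "norm q < 1" and c: "(\<lambda>j. norm (c j)) summable_on UNIV"
  shows "(\<lambda>N. \<Sum>j=-int (N+e)..int N. c j * inv_qfac q (int N - j) * inv_qfac q (int (N+e) + j))
           \<longlonglongrightarrow> (\<Sum>\<^sub>\<infinity>j. c j) / euler_E q ^ 2"
proof -
  obtain C where C: "C > 0" "\<And>m. norm (inv_qfac q m) \<le> C" using inv_qfac_bounded[OF q] by blast
  have "(\<lambda>N. \<Sum>\<^sub>\<infinity>j. c j * inv_qfac q (int N - j) * inv_qfac q (int (N+e) + j))
     \<longlonglongrightarrow> (\<Sum>\<^sub>\<infinity>j. c j * (1 / euler_E q) * (1 / euler_E q))"
  proof (rule infsum_dominated_LIMSEQ)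
    fix j
    show "(\<lambda>N. c j * inv_qfac q (int N - j) * inv_qfac q (int (N+e) + j))
      \<longlonglongrightarrow> c j * (1 / euler_E q) * (1 / euler_E q)"
      using inv_qfac_LIMSEQ[OF q, of "-j"] inv_qfac_LIMSEQ[OF q, of "int e + j"]
      by (intro tendsto_mult tendsto_const) (simp_all add: add_ac)
    fix N
    show "norm (c j * inv_qfac q (int N - j) * inv_qfac q (int (N+e) + j)) \<le> norm (c j) * C * C"
      unfolding norm_mult using C by (intro mult_mono) (auto simp: less_imp_le)
  next
    show "(\<lambda>j. norm (c j) * C * C) summable_on UNIV"
      by (intro summable_on_cmult_left c)
  qed
  also have "(\<Sum>\<^sub>\<infinity>j. c j * (1 / euler_E q) * (1 / euler_E q)) = (\<Sum>\<^sub>\<infinity>j. c j) / euler_E q ^ 2"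
    by (simp add: infsum_cmult_left' power2_eq_square mult.assoc divide_inverse)
  also have "(\<lambda>N. \<Sum>\<^sub>\<infinity>j. c j * inv_qfac q (int N - j) * inv_qfac q (int (N+e) + j))
    = (\<lambda>N. \<Sum>j=-int (N+e)..int N. c j * inv_qfac q (int N - j) * inv_qfac q (int (N+e) + j))"
  proof
    fix N
    have "(\<Sum>\<^sub>\<infinity>j. c j * inv_qfac q (int N - j) * inv_qfac q (int (N+e) + j))
      = (\<Sum>\<^sub>\<infinity>j\<in>{-int (N+e)..int N}. c j * inv_qfac q (int N - j) * inv_qfac q (int (N+e) + j))"
      by (rule infsum_cong_neutral) auto
    thus "(\<Sum>\<^sub>\<infinity>j. c j * inv_qfac q (int N - j) * inv_qfac q (int (N+e) + j))
      = (\<Sum>j=-int (N+e)..int N. c j * inv_qfac q (int N - j) * inv_qfac q (int (N+e) + j))" by simp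
  qed
  finally show ?thesis .
qed

text \<open>The limit of the finite form with \<open>m = n = N\<close>. The series side acquires
  \<open>1 / E(q)^2\<close> and the product side \<open>1 / E(q)\<close>, which leaves one factor
  \<open>E(q)\<close>.\<close>

lemma jacobi_triple_product:
  fixes q w :: complex
  assumes q: "norm q < 1" "q \<noteq> 0" and w: "w \<noteq> 0"
    and s: "(\<lambda>j. norm (w powi j * q powi tri j)) summable_on UNIV"
  shows "(\<Sum>\<^sub>\<infinity>j. w powi j * q powi tri j)
           = qpoch_inf (-w) q * qpoch_inf (-(q / w)) q * euler_E q"
proof -
  let ?S = "\<Sum>\<^sub>\<infinity>j. w powi j * q powi tri j"
  have "(\<lambda>N. qpoch (-w) q N * qpoch (-(q / w)) q N * inv_qfac q (int N + int N)) \<longlonglongrightarrow> ?S / euler_E q ^ 2"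
    using bilateral_sum_LIMSEQ[OF q(1) s, of 0]
    unfolding add_0_right finite_jacobi_triple_product[OF q w] .
  moreover have "(\<lambda>N. inv_qfac q (int N + int N)) \<longlonglongrightarrow> 1 / euler_E q"
  proof -
    have "filterlim (\<lambda>N::nat. N + N) at_top sequentially"
      by (rule filterlim_at_top_mono[OF filterlim_ident]) auto
    from filterlim_compose[OF inv_qfac_LIMSEQ[OF q(1), of 0] this] show ?thesis by simp
  qed
  hence "(\<lambda>N. qpoch (-w) q N * qpoch (-(q / w)) q N * inv_qfac q (int N + int N))
     \<longlonglongrightarrow> qpoch_inf (-w) q * qpoch_inf (-(q / w)) q * (1 / euler_E q)"
    by (intro tendsto_mult qpoch_LIMSEQ q)
  ultimately have "?S / euler_E q ^ 2 = qpoch_inf (-w) q * qpoch_inf (-(q / w)) q * (1 / euler_E q)"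
    by (rule LIMSEQ_unique)
  thus ?thesis using euler_E_nonzero[OF q(1)] by (simp add: field_simps power2_eq_square)
qed

section \<open>Absolute summability of series with quadratic exponents\<close>

lemma summable_on_int_power_abs:
  fixes x :: real
  assumes "0 \<le> x" "x < 1"
  shows "(\<lambda>n::int. x ^ nat \<bar>n\<bar>) summable_on UNIV"
proof -
  have s: "(\<lambda>n::nat. x ^ n) summable_on UNIV"
    using assms by (intro summable_nonneg_imp_summable_on summable_geometric) auto
  have "(\<lambda>n::int. x ^ nat \<bar>n\<bar>) summable_on range int"
    using s by (subst summable_on_reindex) (auto simp: o_def)
  moreover have "(\<lambda>n::int. x ^ nat \<bar>n\<bar>) summable_on range (\<lambda>n. - int n)"
    using s by (subst summable_on_reindex) (auto simp: o_def inj_on_def)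
  ultimately have "(\<lambda>n::int. x ^ nat \<bar>n\<bar>) summable_on (range int \<union> range (\<lambda>n. - int n))"
    by (rule summable_on_union)
  also have "range int \<union> range (\<lambda>n. - int n) = UNIV"
  proof -
    have "n \<in> range int \<union> range (\<lambda>n. - int n)" for n
      by (cases n rule: int_cases2) auto
    thus ?thesis by blast
  qed
  finally show ?thesis .
qed

lemma norm_powi_le:
  fixes q :: complex
  assumes "norm q < 1" "\<bar>n\<bar> \<le> m"
  shows "norm (q powi m) \<le> norm q ^ nat \<bar>n\<bar>"
proof -
  have "norm (q powi m) = norm q ^ nat m"
    using assms by (simp add: power_int_def norm_power)
  also have "\<dots> \<le> norm q ^ nat \<bar>n\<bar>"
    using assms by (intro power_decreasing) auto
  finally show ?thesis .
qed

text \<open>Comparison with the two-sided geometric series of \<open>|q|^|n|\<close>, for which a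
  linear lower bound on the exponents suffices.\<close>

lemma abs_summable_theta:
  fixes q :: complex
  assumes "norm q < 1" "\<And>n. \<bar>n\<bar> \<le> e n" "\<And>n. norm (c n) \<le> 1"
  shows "(\<lambda>n::int. norm (c n * q powi e n)) summable_on UNIV"
proof (rule Infinite_Sum.abs_summable_on_comparison_test'[OF summable_on_int_power_abs[of "norm q"]])
  show "norm (c n * q powi e n) \<le> norm q ^ nat \<bar>n\<bar>" for n
    using mult_mono[OF assms(3)[of n] norm_powi_le[OF assms(1) assms(2)[of n]]] by (simp add: norm_mult)
qed (use assms in auto)

text \<open>Bailey's lemma in the limiting form used by Bressoud: a factor \<open>q^(j (j + e))\<close> is traded for
  an outer sum. Two applications reduce the Rogers-Ramanujan series to the finite triple product,
  which vanishes except in its lowest instance.\<close>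
lemma bailey_step:
  fixes c :: "int \<Rightarrow> complex"
  assumes q: "norm q < 1" "q \<noteq> 0" and e: "e \<le> 1"
  shows "(\<Sum>j=-int (N+e)..int N. q powi (j * (j + int e)) * c j * inv_qfac q (int N - j) * inv_qfac q (int (N+e) + j))
    = (\<Sum>s=0..int N. q powi (s * (s + int e)) * inv_qfac q (int N - s) *
         (\<Sum>j=-(s + int e)..s. c j * inv_qfac q (s - j) * inv_qfac q (s + int e + j)))"
    (is "?L = ?R")
proof -
  let ?J = "{-int (N+e)..int N}"
  have "?L = (\<Sum>j\<in>?J. \<Sum>s=0..int N. q powi (s * (s + int e)) * inv_qfac q (int N - s) *
     (c j * inv_qfac q (s - j) * inv_qfac q (s + int e + j)))"
  proof (rule sum.cong[OF refl])
    fix j assume j: "j \<in> ?J"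
    let ?t = "\<lambda>s. q powi (s * (s + int e)) * inv_qfac q (int N - s) * inv_qfac q (s - j) * inv_qfac q (s + int e + j)"
    \<comment> \<open>\<open>N + e + j\<close> is read as \<open>N - b\<close> with
      \<open>b = -j - e\<close>, so that q-Chu-Vandermonde with \<open>a = j\<close> expands the
      product of the two reciprocal factorials.\<close>
    have "q powi (j * (j + int e)) * inv_qfac q (int N - j) * inv_qfac q (int (N+e) + j)
      = q powi (j * (j + int e)) * (inv_qfac q (int N - j) * inv_qfac q (int N - (-j-int e)))"
      by (simp add: algebra_simps)
    also have "\<dots> = (\<Sum>s=j..int N. ?t s)"
      unfolding q_chu_vandermonde[OF q, symmetric] sum_distrib_left
    proof (rule sum.cong[OF refl])
      fix s
      have "j * (j + int e) + (s - j) * (s - (-j-int e)) = s * (s + int e)" by (simp add: algebra_simps)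
      hence "q powi (s * (s + int e)) = q powi (j * (j + int e)) * q powi ((s - j) * (s - (-j-int e)))"
        using q by (metis power_int_add)
      thus "q powi (j * (j + int e)) * (q powi ((s - j) * (s - (-j-int e))) * inv_qfac q (int N - s) * inv_qfac q (s - j) * inv_qfac q (s - (-j-int e))) = ?t s"
        by (simp add: algebra_simps)
    qed
    also have "\<dots> = (\<Sum>s\<in>{min 0 j..int N}. ?t s)"
      by (rule sum.mono_neutral_left) auto
    \<comment> \<open>For \<open>s < 0\<close> the numbers \<open>s - j\<close> and
      \<open>s + e + j\<close> add up to \<open>2 s + e < 0\<close> because
      \<open>e \<le> 1\<close>, so one of them is negative and the term vanishes.\<close>
    also have "\<dots> = (\<Sum>s=0..int N. ?t s)"
    proof (rule sum.mono_neutral_right)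
      show "\<forall>s\<in>{min 0 j..int N} - {0..int N}. ?t s = 0"
      proof
        fix s assume "s \<in> {min 0 j..int N} - {0..int N}"
        hence "s - j < 0 \<or> s + int e + j < 0" using e by (auto simp: min_def split: if_splits)
        thus "?t s = 0" by (auto simp: mult_eq_0_iff)
      qed
    qed auto
    finally have *: "q powi (j * (j + int e)) * inv_qfac q (int N - j) * inv_qfac q (int (N+e) + j) = (\<Sum>s=0..int N. ?t s)" .
    have "q powi (j * (j + int e)) * c j * inv_qfac q (int N - j) * inv_qfac q (int (N+e) + j)
      = c j * (q powi (j * (j + int e)) * inv_qfac q (int N - j) * inv_qfac q (int (N+e) + j))"
      by (simp add: mult_ac)
    also have "\<dots> = c j * (\<Sum>s=0..int N. ?t s)" by (simp only: *)
    finally show "q powi (j * (j + int e)) * c j * inv_qfac q (int N - j) * inv_qfac q (int (N+e) + j)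
      = (\<Sum>s=0..int N. q powi (s * (s + int e)) * inv_qfac q (int N - s) *
     (c j * inv_qfac q (s - j) * inv_qfac q (s + int e + j)))"
      by (simp add: sum_distrib_left mult_ac)
  qed
  also have "\<dots> = (\<Sum>s=0..int N. q powi (s * (s + int e)) * inv_qfac q (int N - s) *
       (\<Sum>j\<in>?J. c j * inv_qfac q (s - j) * inv_qfac q (s + int e + j)))"
    unfolding sum_distrib_left by (rule sum.swap)
  also have "\<dots> = ?R"
  proof (rule sum.cong[OF refl])
    fix s assume "s \<in> {0..int N}"
    hence "(\<Sum>j\<in>?J. c j * inv_qfac q (s - j) * inv_qfac q (s + int e + j))
      = (\<Sum>j=-(s + int e)..s. c j * inv_qfac q (s - j) * inv_qfac q (s + int e + j))"
      by (intro sum.mono_neutral_right) auto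
    thus "q powi (s * (s + int e)) * inv_qfac q (int N - s) * (\<Sum>j\<in>?J. c j * inv_qfac q (s - j) * inv_qfac q (s + int e + j))
      = q powi (s * (s + int e)) * inv_qfac q (int N - s) *
         (\<Sum>j=-(s + int e)..s. c j * inv_qfac q (s - j) * inv_qfac q (s + int e + j))"
      by (simp only:)
  qed
  finally show ?thesis .
qed

section \<open>The Rogers-Ramanujan identities\<close>

text \<open>For \<open>c\<^sup>2 = 1\<close> this is Ramanujan's \<open>f (c q^b, c q^(a - b))\<close>.\<close>
definition theta :: "complex \<Rightarrow> int \<Rightarrow> int \<Rightarrow> complex \<Rightarrow> complex" where
  "theta c a b q = (\<Sum>\<^sub>\<infinity>n. c powi n * q powi (a * tri n + b * n))"

lemma theta_exponent_ge:
  assumes "0 < b" "b < a"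
  shows "\<bar>n\<bar> \<le> a * tri n + b * n"
proof (cases "n > 0")
  case True
  have "0 \<le> n * (n - 1)" using True by simp
  hence "0 \<le> tri n" using two_tri[of n] by simp
  hence "0 \<le> a * tri n" using assms by simp
  moreover have "1 * n \<le> b * n" using assms True by (intro mult_right_mono) auto
  ultimately show ?thesis using True by linarith
next
  case False
  \<comment> \<open>For \<open>n \<le> 0\<close> the exponent is regrouped as
    \<open>a (tri n + n) + (a - b) (-n)\<close>, where \<open>tri n + n = n (n + 1) / 2\<close> is
    nonnegative.\<close>
  have "0 \<le> n * (n + 1)" using False by (cases "n = 0") (auto intro: mult_nonpos_nonpos)
  hence "0 \<le> tri n + n" using two_tri[of n] by (simp add: algebra_simps)
  hence "0 \<le> a * (tri n + n)" using assms by simp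
  moreover have "1 * (-n) \<le> (a - b) * (-n)" using assms False by (intro mult_right_mono) auto
  ultimately show ?thesis using False by (simp add: algebra_simps)
qed

lemma theta_abs_summable:
  fixes q :: complex
  assumes "norm q < 1" "0 < b" "b < a" "norm c = 1"
  shows "(\<lambda>n. norm (c powi n * q powi (a * tri n + b * n))) summable_on UNIV"
  using assms theta_exponent_ge[of b a]
  by (intro abs_summable_theta) (auto simp: norm_power_int)

text \<open>The triple product in base \<open>q^a\<close> at \<open>w = c q^b\<close>; since
  \<open>1 / c = c\<close> for both signs, \<open>q^a / w\<close> is
  \<open>c q^(a - b)\<close>.\<close>

lemma theta_product:
  assumes q: "norm q < 1" "q \<noteq> 0" and ab: "0 < b" "b < a" and c: "c = 1 \<or> c = -1"
  shows "theta c (int a) (int b) q = qpoch_inf (-c * q ^ b) (q ^ a) * qpoch_inf (-c * q ^ (a - b)) (q ^ a) * euler_E (q ^ a)"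
proof -
  have eq: "c powi n * q powi (int a * tri n + int b * n) = (c * q ^ b) powi n * (q ^ a) powi tri n" for n
    by (simp only: power_int_add[of q, OF disjI1[OF q(2)]] power_int_mult_distrib power_int_mult power_int_of_nat mult.assoc)
       (simp only: mult.commute)
  have "theta c (int a) (int b) q = (\<Sum>\<^sub>\<infinity>n. (c * q ^ b) powi n * (q ^ a) powi tri n)"
    unfolding theta_def eq ..
  also have "\<dots> = qpoch_inf (-(c * q ^ b)) (q ^ a) * qpoch_inf (-(q ^ a / (c * q ^ b))) (q ^ a) * euler_E (q ^ a)"
  proof (rule jacobi_triple_product)
    show "norm (q ^ a) < 1" using q ab by (simp add: norm_power power_less_one_iff)
    show "q ^ a \<noteq> 0" "c * q ^ b \<noteq> 0" using q c by auto
    show "(\<lambda>n. norm ((c * q ^ b) powi n * (q ^ a) powi tri n)) summable_on UNIV"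
      unfolding eq[symmetric] using theta_abs_summable[of q "int b" "int a" c] assms by auto
  qed
  also have "q ^ a / (c * q ^ b) = c * q ^ (a - b)"
    using c q ab by (auto simp: power_diff)
  finally show ?thesis by simp
qed

text \<open>At \<open>w = -q^(1-e)\<close> the finite triple product contains
  \<open>(1; q)_N\<close>, so the bare sum over \<open>c\<close> is 1 for \<open>N = 0\<close> and 0
  otherwise. One Bailey step turns this into \<open>1 / (q; q)_N\<close>, a second one into the
  right-hand side. The cases \<open>e = 0\<close> and \<open>e = 1\<close> lead to \<open>G\<close>
  and \<open>H\<close>.\<close>

lemma rogers_ramanujan_finite:
  assumes q: "norm q < 1" "q \<noteq> 0" and e: "e \<le> 1"
  defines "c \<equiv> \<lambda>j. (-(q ^ (1 - e))) powi j * q powi tri j"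
  shows "(\<Sum>j=-int (N+e)..int N. q powi (j * (j + int e)) * (q powi (j * (j + int e)) * c j)
            * inv_qfac q (int N - j) * inv_qfac q (int (N+e) + j))
         = (\<Sum>s=0..int N. q powi (s * (s + int e)) * inv_qfac q (int N - s) * inv_qfac q s)"
proof -
  have c0: "(\<Sum>j=-int (N+e)..int N. c j * inv_qfac q (int N - j) * inv_qfac q (int (N+e) + j))
      = (if N = 0 then 1 else 0)" for N
  proof -
    have "(\<Sum>j=-int (N+e)..int N. c j * inv_qfac q (int N - j) * inv_qfac q (int (N+e) + j))
      = qpoch (q ^ (1 - e)) q N * qpoch (q / q ^ (1 - e)) q (N + e) * inv_qfac q (int N + int (N + e))"
      unfolding c_def using finite_jacobi_triple_product[OF q, where w = "-(q ^ (1 - e))" and m = "N + e" and n = N] q by simp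
    also have "\<dots> = (if N = 0 then 1 else 0)"
      using e q qpoch_self_nonzero[OF q(1), of "Suc 0"] inv_qfac_of_nat[of q 1]
      by (cases "e = 0") (auto simp: qpoch_one not_le Suc_le_eq le_Suc_eq)
    finally show ?thesis .
  qed
  have c1: "(\<Sum>j=-int (N+e)..int N. q powi (j * (j + int e)) * c j * inv_qfac q (int N - j) * inv_qfac q (int (N+e) + j))
      = inv_qfac q (int N)" for N
  proof -
    have "(\<Sum>j=-int (N+e)..int N. q powi (j * (j + int e)) * c j * inv_qfac q (int N - j) * inv_qfac q (int (N+e) + j))
      = (\<Sum>s=0..int N. q powi (s * (s + int e)) * inv_qfac q (int N - s) * (if s = 0 then 1 else 0))"
      unfolding bailey_step[OF q e]
    proof (rule sum.cong[OF refl])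
      fix s assume "s \<in> {0..int N}"
      then obtain k where k: "s = int k" by (metis atLeastAtMost_iff nonneg_int_cases)
      show "q powi (s * (s + int e)) * inv_qfac q (int N - s) *
         (\<Sum>j=-(s + int e)..s. c j * inv_qfac q (s - j) * inv_qfac q (s + int e + j))
         = q powi (s * (s + int e)) * inv_qfac q (int N - s) * (if s = 0 then 1 else 0)"
        using c0[of k] unfolding k by simp
    qed
    also have "\<dots> = (\<Sum>s\<in>{0}. q powi (s * (s + int e)) * inv_qfac q (int N - s) * (if s = 0 then 1 else 0))"
      by (rule sum.mono_neutral_right) auto
    finally show ?thesis by simp
  qed
  show ?thesis
    unfolding bailey_step[OF q e]
  proof (rule sum.cong[OF refl])
    fix s assume "s \<in> {0..int N}"
    then obtain k where k: "s = int k" by (metis atLeastAtMost_iff nonneg_int_cases)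
    show "q powi (s * (s + int e)) * inv_qfac q (int N - s) *
         (\<Sum>j=-(s + int e)..s. q powi (j * (j + int e)) * c j * inv_qfac q (s - j) * inv_qfac q (s + int e + j))
         = q powi (s * (s + int e)) * inv_qfac q (int N - s) * inv_qfac q s"
      using c1[of k] unfolding k by simp
  qed
qed

text \<open>For fixed \<open>s\<close> the factor \<open>inv_qfac q (N - s)\<close> tends to
  \<open>1 / E(q)\<close>. The sum is extended to all integers, where negative \<open>s\<close>
  contribute nothing, and Tannery's theorem applies.\<close>

lemma rogers_ramanujan_sum_LIMSEQ:
  assumes q: "norm q < 1" "q \<noteq> 0"
  shows "(\<lambda>N. \<Sum>s=0..int N. q powi (s * (s + int e)) * inv_qfac q (int N - s) * inv_qfac q s)
      \<longlonglongrightarrow> (\<Sum>n. q ^ (n * (n + e)) / qpoch q q n) / euler_E q"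
proof -
  obtain C where C: "C > 0" "\<And>m. norm (inv_qfac q m) \<le> C" using inv_qfac_bounded[OF q(1)] by blast
  let ?f = "\<lambda>N s. q powi (s * (s + int e)) * inv_qfac q (int N - s) * inv_qfac q s"
  let ?g = "\<lambda>s. q powi (s * (s + int e)) * inv_qfac q s"
  have ge: "\<bar>s\<bar> \<le> s * (s + int e)" if "s \<ge> 0" for s
    using that mult_mono[of 1 "s + int e" s s] by (cases "s = 0") (auto simp: mult_ac)
  have nle: "norm (?g s) \<le> norm q ^ nat \<bar>s\<bar> * C" for s
  proof (cases "s < 0")
    case True
    thus ?thesis using C by simp
  next
    case False
    thus ?thesis unfolding norm_mult using ge[of s] C q norm_powi_le[OF q(1), of s "s * (s + int e)"]
      by (intro mult_mono) auto
  qed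
  have smr: "(\<lambda>s. norm q ^ nat \<bar>s\<bar> * C) summable_on UNIV"
    using q by (intro summable_on_cmult_left summable_on_int_power_abs) auto
  have "(\<lambda>N. \<Sum>\<^sub>\<infinity>s. ?f N s) \<longlonglongrightarrow> (\<Sum>\<^sub>\<infinity>s. q powi (s * (s + int e)) * (1 / euler_E q) * inv_qfac q s)"
  proof (rule infsum_dominated_LIMSEQ)
    fix s :: int
    show "(\<lambda>N. ?f N s) \<longlonglongrightarrow> q powi (s * (s + int e)) * (1 / euler_E q) * inv_qfac q s"
      using inv_qfac_LIMSEQ[OF q(1), of "-s"] by (intro tendsto_mult tendsto_const) simp_all
    fix N
    have "norm (?f N s) = norm (?g s) * norm (inv_qfac q (int N - s))"
      by (simp add: norm_mult)
    also have "\<dots> \<le> (norm q ^ nat \<bar>s\<bar> * C) * C"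
      using nle C by (intro mult_mono) (auto simp: less_imp_le)
    finally show "norm (?f N s) \<le> norm q ^ nat \<bar>s\<bar> * C * C" .
  next
    show "(\<lambda>s. norm q ^ nat \<bar>s\<bar> * C * C) summable_on UNIV"
      by (intro summable_on_cmult_left smr)
  qed
  also have "(\<Sum>\<^sub>\<infinity>s. q powi (s * (s + int e)) * (1 / euler_E q) * inv_qfac q s) = (\<Sum>\<^sub>\<infinity>s. ?g s) / euler_E q"
    unfolding divide_inverse infsum_cmult_left'[symmetric] by (simp add: mult_ac)
  also have "(\<Sum>\<^sub>\<infinity>s. ?g s) = (\<Sum>n. q ^ (n * (n + e)) / qpoch q q n)"
  proof -
    have "?g summable_on UNIV"
      by (rule Infinite_Sum.abs_summable_summable, rule Infinite_Sum.abs_summable_on_comparison_test'[OF smr nle])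
    hence "(?g has_sum (\<Sum>\<^sub>\<infinity>s. ?g s)) UNIV" by simp
    moreover have "?g s = 0" if "s \<notin> range int" for s
    proof -
      have "s < 0" using that by (metis nonneg_int_cases not_le rangeI)
      thus ?thesis by simp
    qed
    ultimately have "(?g has_sum (\<Sum>\<^sub>\<infinity>s. ?g s)) (range int)"
      by (subst has_sum_cong_neutral[where T = UNIV and g = ?g]) auto
    hence "((\<lambda>n. ?g (int n)) has_sum (\<Sum>\<^sub>\<infinity>s. ?g s)) UNIV"
      by (subst (asm) has_sum_reindex) (auto simp: o_def)
    hence "(\<lambda>n. ?g (int n)) sums (\<Sum>\<^sub>\<infinity>s. ?g s)" by (rule has_sum_imp_sums)
    moreover have "?g (int n) = q ^ (n * (n + e)) / qpoch q q n" for n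
      unfolding inv_qfac_of_nat of_nat_add[symmetric] of_nat_mult[symmetric] power_int_of_nat by simp
    ultimately show ?thesis by (simp add: sums_iff)
  qed
  also have "(\<lambda>N. \<Sum>\<^sub>\<infinity>s. ?f N s) = (\<lambda>N. \<Sum>s=0..int N. ?f N s)"
  proof
    fix N
    have "(\<Sum>\<^sub>\<infinity>s. ?f N s) = (\<Sum>\<^sub>\<infinity>s\<in>{0..int N}. ?f N s)"
      by (rule infsum_cong_neutral) auto
    thus "(\<Sum>\<^sub>\<infinity>s. ?f N s) = (\<Sum>s=0..int N. ?f N s)" by simp
  qed
  finally show ?thesis .
qed

text \<open>The two sides of the finite identity tend to limits carrying \<open>1 / E(q)^2\<close>
  and \<open>1 / E(q)\<close>. The exponents from the two Bailey steps and from the triple product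
  add up to \<open>5 tri j + (3 + e) j\<close>.\<close>

lemma rogers_ramanujan:
  assumes q: "norm q < 1" "q \<noteq> 0" and e: "e \<le> 1"
  shows "euler_E q * (\<Sum>n. q ^ (n * (n + e)) / qpoch q q n) = theta (-1) 5 (3 + int e) q"
proof -
  define c where "c = (\<lambda>j. q powi (j * (j + int e)) * (q powi (j * (j + int e)) * ((-(q ^ (1 - e))) powi j * q powi tri j)))"
  have c: "c j = (-1) powi j * q powi (5 * tri j + (3 + int e) * j)" for j
  proof -
    have 1: "5 * tri j + (3 + int e) * j = j * (j + int e) + (j * (j + int e) + ((1 - int e) * j + tri j))"
      using two_tri[of j] by (simp add: algebra_simps)
    have 2: "(-(q ^ (1 - e))) powi j = (-1) powi j * q powi ((1 - int e) * j)"
    proof -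
      have "(-(q ^ (1 - e))) powi j = ((-1) * q powi (1 - int e)) powi j"
        using e by (simp add: power_int_def nat_diff_distrib)
      thus ?thesis by (simp only: power_int_mult_distrib power_int_mult)
    qed
    show ?thesis unfolding c_def 1 2
      by (simp only: power_int_add[of q, OF disjI1[OF q(2)]] mult_ac)
  qed
  have "(\<lambda>N. \<Sum>j=-int (N+e)..int N. c j * inv_qfac q (int N - j) * inv_qfac q (int (N+e) + j))
           \<longlonglongrightarrow> (\<Sum>\<^sub>\<infinity>j. c j) / euler_E q ^ 2"
    using theta_abs_summable[of q "3 + int e" 5 "-1"] q e
    by (intro bilateral_sum_LIMSEQ) (simp_all add: c)
  hence "(\<lambda>N. \<Sum>s=0..int N. q powi (s * (s + int e)) * inv_qfac q (int N - s) * inv_qfac q s)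
      \<longlonglongrightarrow> (\<Sum>\<^sub>\<infinity>j. c j) / euler_E q ^ 2"
    unfolding c_def using rogers_ramanujan_finite[OF q e] by simp
  from LIMSEQ_unique[OF this rogers_ramanujan_sum_LIMSEQ[OF q]]
  have "(\<Sum>\<^sub>\<infinity>j. c j) / euler_E q ^ 2 = (\<Sum>n. q ^ (n * (n + e)) / qpoch q q n) / euler_E q" .
  moreover have "(\<Sum>\<^sub>\<infinity>j. c j) = theta (-1) 5 (3 + int e) q" by (simp add: theta_def c)
  ultimately show ?thesis using euler_E_nonzero[OF q(1)] by (simp add: field_simps power2_eq_square)
qed

lemma euler_E_RR_G: "norm q < 1 \<Longrightarrow> q \<noteq> 0 \<Longrightarrow> euler_E q * RR_G q = theta (-1) 5 3 q"
  using rogers_ramanujan[of q 0] by (simp add: RR_G_def power2_eq_square)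

lemma euler_E_RR_H: "norm q < 1 \<Longrightarrow> q \<noteq> 0 \<Longrightarrow> euler_E q * RR_H q = theta (-1) 5 4 q"
  using rogers_ramanujan[of q 1] by (simp add: RR_H_def)

section \<open>Infinite product manipulations\<close>

lemma qpoch_mult:
  "qpoch a q (n * m) = (\<Prod>i<m. qpoch (a * q ^ i) (q ^ m) n)"
proof -
  have "qpoch a q (n * m) = (\<Prod>l<n. \<Prod>k=l*m..<l*m+m. 1 - a * q ^ k)"
    unfolding qpoch_def by (rule prod.nat_group[symmetric])
  also have "\<dots> = (\<Prod>l<n. \<Prod>i<m. 1 - a * q ^ i * (q ^ m) ^ l)"
  proof (rule prod.cong[OF refl])
    fix l
    show "(\<Prod>k=l*m..<l*m+m. 1 - a * q ^ k) = (\<Prod>i<m. 1 - a * q ^ i * (q ^ m) ^ l)"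
      by (rule prod.reindex_bij_witness[of _ "\<lambda>i. l * m + i" "\<lambda>k. k - l * m"])
         (auto simp: mult_ac simp flip: power_mult power_add)
  qed
  also have "\<dots> = (\<Prod>i<m. qpoch (a * q ^ i) (q ^ m) n)"
    unfolding qpoch_def by (rule prod.swap)
  finally show ?thesis .
qed

lemma norm_power_less_1: "norm (q::complex) < 1 \<Longrightarrow> m > 0 \<Longrightarrow> norm (q ^ m) < 1"
  by (simp add: norm_power power_less_one_iff)

text \<open>The factors are sorted by \<open>k\<close> modulo \<open>m\<close>; the limit is taken
  along multiples of \<open>m\<close>, where the finite splitting is exact.\<close>

lemma qpoch_inf_dissect:
  assumes q: "norm q < 1" and m: "m > 0"
  shows "qpoch_inf a q = (\<Prod>i<m. qpoch_inf (a * q ^ i) (q ^ m))"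
proof -
  have "filterlim (\<lambda>n. n * m) at_top sequentially"
    by (rule filterlim_at_top_mono[OF filterlim_ident]) (use m in auto)
  from filterlim_compose[OF qpoch_LIMSEQ[OF q] this]
  have "(\<lambda>n. \<Prod>i<m. qpoch (a * q ^ i) (q ^ m) n) \<longlonglongrightarrow> qpoch_inf a q"
    unfolding qpoch_mult .
  moreover have "(\<lambda>n. \<Prod>i<m. qpoch (a * q ^ i) (q ^ m) n) \<longlonglongrightarrow> (\<Prod>i<m. qpoch_inf (a * q ^ i) (q ^ m))"
    by (intro tendsto_prod qpoch_LIMSEQ norm_power_less_1 assms)
  ultimately show ?thesis by (rule LIMSEQ_unique)
qed

lemma qpoch_inf_dissect_power:
  assumes "norm q < 1" "m > 0" "k > 0"
  shows "qpoch_inf (q ^ b) (q ^ m) = (\<Prod>i<k. qpoch_inf (q ^ (b + m * i)) (q ^ (m * k)))"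
  using qpoch_inf_dissect[OF norm_power_less_1[OF assms(1,2)] assms(3), of "q ^ b"]
  by (simp add: power_mult power_add)

text \<open>\<open>(1 + x) (1 - x) = 1 - x^2\<close> factor by factor; this rewrites products with a
  negated argument through ordinary ones.\<close>

lemma qpoch_inf_mult_neg:
  assumes q: "norm q < 1"
  shows "qpoch_inf (-a) q * qpoch_inf a q = qpoch_inf (a\<^sup>2) (q\<^sup>2)"
proof -
  have "qpoch (-a) q n * qpoch a q n = qpoch (a\<^sup>2) (q\<^sup>2) n" for n
    unfolding qpoch_def prod.distrib[symmetric]
    by (intro prod.cong refl) (simp add: power2_eq_square power_mult_distrib algebra_simps)
  hence "(\<lambda>n. qpoch (a\<^sup>2) (q\<^sup>2) n) \<longlonglongrightarrow> qpoch_inf (-a) q * qpoch_inf a q"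
    using tendsto_mult[OF qpoch_LIMSEQ[OF q, of "-a"] qpoch_LIMSEQ[OF q, of a]] by simp
  with qpoch_LIMSEQ[of "q\<^sup>2" "a\<^sup>2"] show ?thesis
    using q norm_power_less_1[of q 2] LIMSEQ_unique by fastforce
qed

lemma theta_power: "q \<noteq> 0 \<Longrightarrow> theta c a b (q ^ k) = theta c (int k * a) (int k * b) q"
  unfolding theta_def
proof (intro infsum_cong, goal_cases)
  case (1 n)
  have "int k * a * tri n + int k * b * n = int k * (a * tri n + b * n)" by (simp add: algebra_simps)
  thus ?case by (simp only: power_int_mult power_int_of_nat)
qed

lemma theta_neg_nonzero:
  assumes q: "norm q < 1" "q \<noteq> 0" and ab: "0 < b" "b < a"
  shows "theta (-1) (int a) (int b) q \<noteq> 0"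
  using assms by (simp add: theta_product qpoch_inf_nonzero euler_E_nonzero norm_power_less_1)

section \<open>Comparison of products by residue classes modulo 20\<close>

context
  fixes q :: complex
  assumes q: "norm q < 1" "q \<noteq> 0"
begin

text \<open>20 is a common multiple of all moduli that occur, so after clearing denominators every
  product below is a monomial in the nonzero \<open>P i\<close>, and identities reduce to comparing
  factors.\<close>

private definition P where "P i = qpoch_inf (q ^ i) (q ^ 20)"

private lemma P_nonzero: "i > 0 \<Longrightarrow> P i \<noteq> 0"
  unfolding P_def using q by (intro qpoch_inf_nonzero norm_power_less_1) auto

private lemma qpoch_inf_P:
  assumes "m * k = 20"
  shows "qpoch_inf (q ^ b) (q ^ m) = (\<Prod>i<k. P (b + m * i))"
proof -
  have "m > 0" "k > 0" using assms by (auto intro!: Nat.gr0I)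
  thus ?thesis using qpoch_inf_dissect_power[OF q(1), of m k b] assms by (simp add: P_def)
qed

private lemma qpoch_inf_neg_P: "qpoch_inf (-(q ^ b)) (q ^ 10) * (P b * P (b + 10)) = P (2 * b)"
  using qpoch_inf_mult_neg[of "q ^ 10" "q ^ b"] qpoch_inf_P[of 10 2 b] norm_power_less_1[OF q(1), of 10]
  by (simp add: P_def power_mult[symmetric] lessThan_nat_numeral mult_ac)

private lemma euler_E_P:
  "euler_E q = P 1 * P 2 * P 3 * P 4 * P 5 * P 6 * P 7 * P 8 * P 9 * P 10
     * P 11 * P 12 * P 13 * P 14 * P 15 * P 16 * P 17 * P 18 * P 19 * P 20"
  "euler_E (q ^ 2) = P 2 * P 4 * P 6 * P 8 * P 10 * P 12 * P 14 * P 16 * P 18 * P 20"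
  "euler_E (q ^ 4) = P 4 * P 8 * P 12 * P 16 * P 20"
  "euler_E (q ^ 5) = P 5 * P 10 * P 15 * P 20"
  "euler_E (q ^ 10) = P 10 * P 20"
  "euler_E (q ^ 20) = P 20"
  unfolding euler_E_def
  using qpoch_inf_P[of 1 20 1] qpoch_inf_P[of 2 10 2] qpoch_inf_P[of 4 5 4] qpoch_inf_P[of 5 4 5]
    qpoch_inf_P[of 10 2 10] qpoch_inf_P[of 20 1 20]
  by (simp_all add: lessThan_nat_numeral flip: numeral_2_eq_2)

text \<open>The factors \<open>E(q)\<close>, \<open>E(q^4)\<close> and
  \<open>P 3 P 13 P 7 P 17\<close> clear the denominators of the Rogers-Ramanujan functions and of
  the theta product; afterwards both sides contain the same factors \<open>P i\<close>.\<close>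

lemma euler_E_RR_H_G:
  "euler_E (q ^ 2) * RR_H q * RR_G (q ^ 4) = theta 1 10 7 q"
proof -
  have H: "euler_E q * RR_H q = (P 4 * P 9 * P 14 * P 19) * (P 1 * P 6 * P 11 * P 16) * (P 5 * P 10 * P 15 * P 20)"
    using theta_product[OF q, of 4 5 "-1"] qpoch_inf_P[of 5 4 4] qpoch_inf_P[of 5 4 1] q
    by (simp add: euler_E_RR_H euler_E_P(4) lessThan_nat_numeral flip: numeral_2_eq_2)
  have G: "euler_E (q ^ 4) * RR_G (q ^ 4) = P 12 * P 8 * P 20"
    using theta_product[OF q, of 12 20 "-1"] norm_power_less_1[OF q(1), of 4] q
    by (simp add: euler_E_RR_G theta_power euler_E_P(6) P_def)
  \<comment> \<open>\<open>P 7 P 17\<close> and \<open>P 3 P 13\<close> turn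
    \<open>(-q^7; q^10)\<close> and \<open>(-q^3; q^10)\<close> into \<open>P 14\<close> and
    \<open>P 6\<close>.\<close>
  have T: "theta 1 10 7 q * (P 3 * P 13 * P 7 * P 17) = P 6 * P 14 * P 10 * P 20"
  proof -
    have "theta 1 10 7 q * (P 3 * P 13 * P 7 * P 17) =
       (qpoch_inf (-(q ^ 7)) (q ^ 10) * (P 7 * P 17)) * (qpoch_inf (-(q ^ 3)) (q ^ 10) * (P 3 * P 13)) * (P 10 * P 20)"
      using theta_product[OF q, of 7 10 1] by (simp add: euler_E_P(5))
    also have "qpoch_inf (-(q ^ 7)) (q ^ 10) * (P 7 * P 17) = P 14"
      using qpoch_inf_neg_P[of 7] by simp
    also have "qpoch_inf (-(q ^ 3)) (q ^ 10) * (P 3 * P 13) = P 6"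
      using qpoch_inf_neg_P[of 3] by simp
    finally show ?thesis by simp
  qed
  have "(euler_E q * euler_E (q ^ 4) * (P 3 * P 13 * P 7 * P 17)) * (euler_E (q ^ 2) * RR_H q * RR_G (q ^ 4))
    = (P 3 * P 13 * P 7 * P 17) * euler_E (q ^ 2) * (euler_E q * RR_H q) * (euler_E (q ^ 4) * RR_G (q ^ 4))"
    by simp
  also have "\<dots> = (euler_E q * euler_E (q ^ 4)) * (theta 1 10 7 q * (P 3 * P 13 * P 7 * P 17))"
    unfolding H G T unfolding euler_E_P by (simp only: mult_ac)
  also have "\<dots> = (euler_E q * euler_E (q ^ 4) * (P 3 * P 13 * P 7 * P 17)) * theta 1 10 7 q"
    by simp
  finally show ?thesis
    using P_nonzero euler_E_nonzero[OF q(1)] euler_E_nonzero[OF norm_power_less_1[OF q(1), of 4]]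
    by simp
qed

lemma euler_E_RR_G_H:
  "euler_E (q ^ 2) * RR_G q * RR_H (q ^ 4) = theta 1 10 9 q"
proof -
  have G: "euler_E q * RR_G q = (P 3 * P 8 * P 13 * P 18) * (P 2 * P 7 * P 12 * P 17) * (P 5 * P 10 * P 15 * P 20)"
    using theta_product[OF q, of 3 5 "-1"] qpoch_inf_P[of 5 4 3] qpoch_inf_P[of 5 4 2] q
    by (simp add: euler_E_RR_G euler_E_P(4) lessThan_nat_numeral flip: numeral_2_eq_2)
  have H: "euler_E (q ^ 4) * RR_H (q ^ 4) = P 16 * P 4 * P 20"
    using theta_product[OF q, of 16 20 "-1"] norm_power_less_1[OF q(1), of 4] q
    by (simp add: euler_E_RR_H theta_power euler_E_P(6) P_def)
  \<comment> \<open>The negated residues modulo 10 are now 9 and 1, cleared by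
    \<open>P 9 P 19\<close> and \<open>P 1 P 11\<close>.\<close>
  have T: "theta 1 10 9 q * (P 1 * P 11 * P 9 * P 19) = P 2 * P 18 * P 10 * P 20"
  proof -
    have "theta 1 10 9 q * (P 1 * P 11 * P 9 * P 19) =
       (qpoch_inf (-(q ^ 9)) (q ^ 10) * (P 9 * P 19)) * (qpoch_inf (-(q ^ 1)) (q ^ 10) * (P 1 * P 11)) * (P 10 * P 20)"
      using theta_product[OF q, of 9 10 1] by (simp add: euler_E_P(5))
    also have "qpoch_inf (-(q ^ 9)) (q ^ 10) * (P 9 * P 19) = P 18"
      using qpoch_inf_neg_P[of 9] by simp
    also have "qpoch_inf (-(q ^ 1)) (q ^ 10) * (P 1 * P 11) = P 2"
      using qpoch_inf_neg_P[of 1] by simp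
    finally show ?thesis by simp
  qed
  have "(euler_E q * euler_E (q ^ 4) * (P 1 * P 11 * P 9 * P 19)) * (euler_E (q ^ 2) * RR_G q * RR_H (q ^ 4))
    = (P 1 * P 11 * P 9 * P 19) * euler_E (q ^ 2) * (euler_E q * RR_G q) * (euler_E (q ^ 4) * RR_H (q ^ 4))"
    by simp
  also have "\<dots> = (euler_E q * euler_E (q ^ 4)) * (theta 1 10 9 q * (P 1 * P 11 * P 9 * P 19))"
    unfolding H G T unfolding euler_E_P by (simp only: mult_ac)
  also have "\<dots> = (euler_E q * euler_E (q ^ 4) * (P 1 * P 11 * P 9 * P 19)) * theta 1 10 9 q"
    by simp
  finally show ?thesis
    using P_nonzero euler_E_nonzero[OF q(1)] euler_E_nonzero[OF norm_power_less_1[OF q(1), of 4]]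
    by simp
qed

end

section \<open>A three-term relation between theta functions\<close>

lemma
  fixes f :: "'a \<Rightarrow> complex" and g :: "'b \<Rightarrow> complex"
  assumes f: "(\<lambda>x. norm (f x)) summable_on A" and g: "(\<lambda>y. norm (g y)) summable_on B"
  shows abs_summable_on_product: "(\<lambda>(x, y). norm (f x * g y)) summable_on A \<times> B"
    and has_sum_product: "((\<lambda>(x, y). f x * g y) has_sum (infsum f A * infsum g B)) (A \<times> B)"
proof -
  have "(\<lambda>p. norm ((\<lambda>(x, y). f x * g y) p)) summable_on A \<times> B"
    unfolding Infinite_Sum.abs_summable_on_Sigma_iff
    using f g infsum_nonneg[of B "\<lambda>y. norm (g y)"]
    by (auto simp: norm_mult abs_mult infsum_cmult_right' intro: summable_on_cmult_left summable_on_cmult_right)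
  thus *: "(\<lambda>(x, y). norm (f x * g y)) summable_on A \<times> B"
    by (simp add: case_prod_unfold)
  have s: "(\<lambda>(x, y). f x * g y) summable_on A \<times> B"
    by (rule Infinite_Sum.abs_summable_summable) (use * in \<open>simp add: case_prod_unfold\<close>)
  have "infsum (\<lambda>(x, y). f x * g y) (A \<times> B) = infsum f A * infsum g B"
    unfolding infsum_Sigma'_banach[OF s, symmetric] by (simp add: infsum_cmult_right' infsum_cmult_left')
  thus "((\<lambda>(x, y). f x * g y) has_sum (infsum f A * infsum g B)) (A \<times> B)"
    using s by (metis has_sum_infsum)
qed

text \<open>Admits exponents that are negative at some places, such as \<open>5 n^2 + 6 n\<close> at
  \<open>n = -1\<close>: the factor \<open>q^(-k)\<close> is pulled out.\<close>

lemma powi_shifted_abs_summable: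
  fixes q :: complex
  assumes q: "norm q < 1" "q \<noteq> 0" and e: "\<And>n. \<bar>n\<bar> \<le> e n + k" and c: "\<And>n. norm (c n) \<le> 1"
  shows "(\<lambda>n::int. norm (c n * q powi e n)) summable_on A"
proof -
  have "(\<lambda>n::int. norm (q powi (-k)) * norm (c n * q powi (e n + k))) summable_on UNIV"
    by (intro summable_on_cmult_right abs_summable_theta q e c)
  also have "(\<lambda>n::int. norm (q powi (-k)) * norm (c n * q powi (e n + k))) = (\<lambda>n. norm (c n * q powi e n))"
    using q by (auto simp: norm_mult power_int_add power_int_minus norm_inverse)
  finally show ?thesis by (rule summable_on_subset_banach) auto
qed

text \<open>Used with \<open>A\<close> the even or the odd integers. The two parts serve as
  coordinates of a plane vector in the three-term relation.\<close>

definition theta_part :: "int set \<Rightarrow> int \<Rightarrow> complex \<Rightarrow> complex" where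
  "theta_part A b q = (\<Sum>\<^sub>\<infinity>n\<in>A. q powi (5 * n\<^sup>2 + b * n))"

lemma abs_le_square: "\<bar>n\<bar> \<le> (n::int)\<^sup>2"
  by (cases "n = 0") (auto simp: power2_eq_square abs_mult_self_eq[symmetric, of n] mult_le_cancel_left1 simp del: abs_mult_self_eq)

lemma theta_part_summable:
  fixes q :: complex
  assumes q: "norm q < 1" "q \<noteq> 0"
  shows "(\<lambda>n. norm (q powi (5 * n\<^sup>2 + b * n))) summable_on A"
proof -
  \<comment> \<open>The shift \<open>b^2\<close> comes from completing the square:
    \<open>b n \<ge> - n^2 - b^2 / 4\<close>, and the remaining \<open>4 n^2\<close> dominates
    \<open>|n|\<close>.\<close>
  have "\<bar>n\<bar> \<le> 5 * n\<^sup>2 + b * n + b\<^sup>2" for n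
  proof -
    have "0 \<le> (2 * n + b)\<^sup>2" by simp
    also have "\<dots> = 4 * n\<^sup>2 + 4 * (b * n) + b\<^sup>2" by (simp add: power2_eq_square algebra_simps)
    finally have "0 \<le> 4 * n\<^sup>2 + 4 * (b * n) + b\<^sup>2" .
    moreover have "\<bar>n\<bar> \<le> n\<^sup>2" "0 \<le> n\<^sup>2" "0 \<le> b\<^sup>2" by (auto simp: abs_le_square)
    ultimately show ?thesis by linarith
  qed
  from powi_shifted_abs_summable[OF q this, of "\<lambda>_. 1" A] show ?thesis by simp
qed

lemma has_sum_theta_part:
  fixes q :: complex
  assumes q: "norm q < 1" "q \<noteq> 0"
  shows "((\<lambda>n. q powi (5 * n\<^sup>2 + b * n)) has_sum theta_part A b q) A"
  unfolding theta_part_def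
  by (rule has_sum_infsum[OF Infinite_Sum.abs_summable_summable[OF theta_part_summable[OF q]]])

lemma theta_10_eq:
  assumes q: "norm q < 1" "q \<noteq> 0"
  shows "theta 1 10 (b + 5) q = theta_part {n. even n} b q + theta_part {n. odd n} b q"
proof -
  have "((\<lambda>n. q powi (5 * n\<^sup>2 + b * n)) has_sum (theta_part {n. even n} b q + theta_part {n. odd n} b q)) ({n. even n} \<union> {n. odd n})"
    by (intro has_sum_Un_disjoint has_sum_theta_part q) auto
  moreover have "{n. even n} \<union> {n. odd n} = (UNIV :: int set)" by auto
  moreover have "10 * tri n + (b + 5) * n = 5 * n\<^sup>2 + b * n" for n
    using two_tri[of n] by (simp add: power2_eq_square algebra_simps)
  ultimately show ?thesis unfolding theta_def by (simp add: infsumI)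
qed

text \<open>Substituting \<open>N = m + n\<close>, \<open>M = m - n\<close> in the double series of the left-hand side.\<close>
lemma theta_20_mult:
  assumes q: "norm q < 1" "q \<noteq> 0" and "\<bar>a + b\<bar> < 10" "\<bar>a - b\<bar> < 10"
  shows "theta (-1) 20 (10 + (a + b)) q * theta (-1) 20 (10 + (a - b)) q
           = theta_part {n. even n} a q * theta_part {n. even n} b q
             - theta_part {n. odd n} a q * theta_part {n. odd n} b q"
proof -
  let ?t = "\<lambda>c n. (-1) powi n * q powi (20 * tri n + (10 + c) * n)"
  let ?u = "\<lambda>a n. q powi (5 * n\<^sup>2 + a * n)"
  \<comment> \<open>The image of \<open>(m, n) -> (m + n, m - n)\<close> consists of the pairs of
    equal parity. The sign \<open>(-1)^N\<close> is 1 on the even block and -1 on the odd one,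
    whence the difference of products.\<close>
  let ?D = "{n::int. even n} \<times> {n::int. even n} \<union> {n::int. odd n} \<times> {n::int. odd n}"
  have "((\<lambda>(m, n). ?t (a + b) m * ?t (a - b) n) has_sum
      theta (-1) 20 (10 + (a + b)) q * theta (-1) 20 (10 + (a - b)) q) (UNIV \<times> UNIV)"
    unfolding theta_def using assms by (intro has_sum_product theta_abs_summable) auto
  also have "?this \<longleftrightarrow> ((\<lambda>(N, M). (-1) powi N * (?u a N * ?u b M)) has_sum
      theta (-1) 20 (10 + (a + b)) q * theta (-1) 20 (10 + (a - b)) q) ?D"
  proof (rule has_sum_reindex_bij_witness[of _ "\<lambda>(N, M). ((N + M) div 2, (N - M) div 2)" "\<lambda>(m, n). (m + n, m - n)"], goal_cases)
    case (5 p)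
    obtain m n where p: "p = (m, n)" by force
    have "5 * (m + n)\<^sup>2 + a * (m + n) + (5 * (m - n)\<^sup>2 + b * (m - n))
      = (20 * tri m + (10 + (a + b)) * m) + (20 * tri n + (10 + (a - b)) * n)"
      using two_tri[of m] two_tri[of n] by (simp add: power2_eq_square algebra_simps)
    hence "?u a (m + n) * ?u b (m - n) = q powi (20 * tri m + (10 + (a + b)) * m) * q powi (20 * tri n + (10 + (a - b)) * n)"
      using q by (metis power_int_add)
    thus ?case by (simp add: p power_int_add mult_ac)
  qed (auto, presburger+)
  finally have 1: "((\<lambda>(N, M). (-1) powi N * (?u a N * ?u b M)) has_sum
      theta (-1) 20 (10 + (a + b)) q * theta (-1) 20 (10 + (a - b)) q) ?D" .
  have "((\<lambda>(N, M). ?u a N * ?u b M) has_sum (theta_part {n. even n} a q * theta_part {n. even n} b q)) ({n. even n} \<times> {n. even n})"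
    unfolding theta_part_def by (intro has_sum_product theta_part_summable q)
  hence 2: "((\<lambda>(N, M). (-1) powi N * (?u a N * ?u b M)) has_sum (theta_part {n. even n} a q * theta_part {n. even n} b q)) ({n. even n} \<times> {n. even n})"
    by (subst has_sum_cong) (auto simp: power_int_minus_left_even)
  have "((\<lambda>(N, M). ?u a N * ?u b M) has_sum (theta_part {n. odd n} a q * theta_part {n. odd n} b q)) ({n. odd n} \<times> {n. odd n})"
    unfolding theta_part_def by (intro has_sum_product theta_part_summable q)
  hence "((\<lambda>p. - ((\<lambda>(N, M). ?u a N * ?u b M) p)) has_sum - (theta_part {n. odd n} a q * theta_part {n. odd n} b q)) ({n. odd n} \<times> {n. odd n})"
    unfolding has_sum_uminus by simp
  hence 3: "((\<lambda>(N, M). (-1) powi N * (?u a N * ?u b M)) has_sum - (theta_part {n. odd n} a q * theta_part {n. odd n} b q)) ({n. odd n} \<times> {n. odd n})"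
    by (subst has_sum_cong) (auto simp: power_int_minus_left_odd)
  have "((\<lambda>(N, M). (-1) powi N * (?u a N * ?u b M)) has_sum (theta_part {n. even n} a q * theta_part {n. even n} b q
     + - (theta_part {n. odd n} a q * theta_part {n. odd n} b q))) ?D"
    by (intro has_sum_Un_disjoint 2 3) auto
  from has_sum_unique[OF 1 this] show ?thesis by simp
qed

text \<open>The substitution \<open>n -> -n - 1\<close> carries \<open>1 + 5 n^2 + 6 n\<close> to
  \<open>5 n^2 + 4 n\<close> and exchanges the parities.\<close>

lemma theta_part_6:
  assumes q: "norm q < 1" "q \<noteq> 0"
  shows "q * theta_part {n. even n} 6 q = theta_part {n. odd n} 4 q"
    and "q * theta_part {n. odd n} 6 q = theta_part {n. even n} 4 q"
proof -
  have e: "q * q powi (5 * n\<^sup>2 + 6 * n) = q powi (5 * (-n - 1)\<^sup>2 + 4 * (-n - 1))" for n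
  proof -
    have "5 * (-n - 1)\<^sup>2 + 4 * (-n - 1) = 1 + (5 * n\<^sup>2 + 6 * n)" by (simp add: power2_eq_square algebra_simps)
    thus ?thesis using q by (simp add: power_int_add)
  qed
  show "q * theta_part {n. even n} 6 q = theta_part {n. odd n} 4 q"
    unfolding theta_part_def infsum_cmult_right'[symmetric] e
    by (rule infsum_reindex_bij_witness[of _ "\<lambda>n. -n-1" "\<lambda>n. -n-1"]) auto
  show "q * theta_part {n. odd n} 6 q = theta_part {n. even n} 4 q"
    unfolding theta_part_def infsum_cmult_right'[symmetric] e
    by (rule infsum_reindex_bij_witness[of _ "\<lambda>n. -n-1" "\<lambda>n. -n-1"]) auto
qed

text \<open>For the plane vectors \<open>v0 = (?E 0, ?O 0)\<close>,
  \<open>v2 = (?O 2, ?E 2)\<close>, \<open>v4 = (?E 4, ?O 4)\<close> and \<open>g\<close>,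
  \<open>h\<close> the theta functions with indices 12, 16, the determinants of
  \<open>(v0, v2)\<close>, \<open>(v4, v2)\<close>, \<open>(v4, v0)\<close> are \<open>g^2\<close>,
  \<open>g h\<close>, \<open>- q h^2\<close>. The theta functions with indices 5, 7, 9 are the
  coordinate sums of \<open>v0\<close>, \<open>v2\<close>, \<open>v4\<close>, so the claim is a
  Pluecker relation.\<close>

lemma theta_three_term:
  assumes q: "norm q < 1" "q \<noteq> 0"
  shows "theta 1 10 9 q * (theta (-1) 20 12 q)\<^sup>2 - q * theta 1 10 7 q * (theta (-1) 20 16 q)\<^sup>2
           = theta 1 10 5 q * theta (-1) 20 12 q * theta (-1) 20 16 q"
proof -
  let ?E = "\<lambda>a. theta_part {n. even n} a q" and ?O = "\<lambda>a. theta_part {n. odd n} a q"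
  \<comment> \<open>The pairs \<open>(a, b) = (2, 0), (4, 2), (6, 0)\<close> are chosen so that
    \<open>10 + a + b\<close> and \<open>10 + a - b\<close> are 12 or 16.\<close>
  have g2: "(theta (-1) 20 12 q)\<^sup>2 = ?E 2 * ?E 0 - ?O 2 * ?O 0"
    using theta_20_mult[OF q, of 2 0] by (simp add: power2_eq_square)
  have gh: "theta (-1) 20 12 q * theta (-1) 20 16 q = ?E 4 * ?E 2 - ?O 4 * ?O 2"
    using theta_20_mult[OF q, of 4 2] by (simp add: mult.commute)
  have "(theta (-1) 20 16 q)\<^sup>2 = ?E 6 * ?E 0 - ?O 6 * ?O 0"
    using theta_20_mult[OF q, of 6 0] by (simp add: power2_eq_square)
  hence "q * (theta (-1) 20 16 q)\<^sup>2 = (q * ?E 6) * ?E 0 - (q * ?O 6) * ?O 0"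
    by (simp only:) (simp add: algebra_simps)
  hence h2: "q * (theta (-1) 20 16 q)\<^sup>2 = ?O 4 * ?E 0 - ?E 4 * ?O 0"
    by (simp add: theta_part_6[OF q])
  have T: "theta 1 10 9 q = ?E 4 + ?O 4" "theta 1 10 7 q = ?E 2 + ?O 2" "theta 1 10 5 q = ?E 0 + ?O 0"
    using theta_10_eq[OF q, of 4] theta_10_eq[OF q, of 2] theta_10_eq[OF q, of 0] by simp_all
  have "theta 1 10 9 q * (theta (-1) 20 12 q)\<^sup>2 - q * theta 1 10 7 q * (theta (-1) 20 16 q)\<^sup>2
    = theta 1 10 9 q * (theta (-1) 20 12 q)\<^sup>2 - theta 1 10 7 q * (q * (theta (-1) 20 16 q)\<^sup>2)"
    by simp
  also have "\<dots> = theta 1 10 5 q * (theta (-1) 20 12 q * theta (-1) 20 16 q)"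
    unfolding g2 gh h2 T by (simp add: algebra_simps)
  finally show ?thesis by (simp add: mult_ac)
qed

section \<open>Ramanujan's identities for G(q)G(q^4) and H(q)H(q^4)\<close>

lemma theta_10_has_sum:
  assumes "norm q < 1" "-5 < b" "b < 5"
  shows "((\<lambda>n. q powi (5 * n\<^sup>2 + b * n)) has_sum theta 1 10 (b + 5) q) UNIV"
    and "(\<lambda>n. norm (q powi (5 * n\<^sup>2 + b * n))) summable_on UNIV"
proof -
  have *: "10 * tri n + (b + 5) * n = 5 * n\<^sup>2 + b * n" for n
    using two_tri[of n] by (simp add: power2_eq_square algebra_simps)
  show s: "(\<lambda>n. norm (q powi (5 * n\<^sup>2 + b * n))) summable_on UNIV"
    using theta_abs_summable[of q "b + 5" 10 1] assms by (simp add: *)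
  show "((\<lambda>n. q powi (5 * n\<^sup>2 + b * n)) has_sum theta 1 10 (b + 5) q) UNIV"
    unfolding theta_def * power_int_1_left mult_1_left
    by (rule has_sum_infsum[OF Infinite_Sum.abs_summable_summable[OF s]])
qed

lemma theta_10_product_has_sum:
  assumes "norm q < 1" "-5 < a" "a < 5" "-5 < b" "b < 5"
  shows "((\<lambda>(k, l). q powi (5 * k\<^sup>2 + a * k) * q powi (5 * l\<^sup>2 + b * l))
            has_sum theta 1 10 (a + 5) q * theta 1 10 (b + 5) q) (UNIV \<times> UNIV)"
  using has_sum_product[OF theta_10_has_sum(2)[of q a] theta_10_has_sum(2)[of q b]]
    theta_10_has_sum(1)[of q a] theta_10_has_sum(1)[of q b] assms by (simp add: infsumI)

lemma ramanujan_phi_has_sum: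
  assumes "norm q < 1"
  shows "((\<lambda>n. q powi n\<^sup>2) has_sum ramanujan_phi q) UNIV"
    and "(\<lambda>n. norm (q powi n\<^sup>2)) summable_on UNIV"
proof -
  show s: "(\<lambda>n. norm (q powi n\<^sup>2)) summable_on UNIV"
    using abs_summable_theta[OF assms abs_le_square, of "\<lambda>_. 1"] by simp
  show "((\<lambda>n. q powi n\<^sup>2) has_sum ramanujan_phi q) UNIV"
    unfolding ramanujan_phi_def
    by (rule has_sum_infsum[OF Infinite_Sum.abs_summable_summable[OF s]])
qed

lemma ramanujan_phi_5:
  assumes "norm q < 1"
  shows "ramanujan_phi (q ^ 5) = theta 1 10 5 q"
proof -
  have "(q ^ 5) powi n\<^sup>2 = q powi (5 * n\<^sup>2 + 0 * n)" for n
    using power_int_mult[of q 5 "n\<^sup>2"] by simp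
  thus ?thesis using theta_10_has_sum(1)[OF assms, of 0] by (simp add: ramanujan_phi_def infsumI)
qed

text \<open>The residue classes of \<open>m + 2 n\<close> modulo 5 split the Gaussian integers \<open>m + i n\<close> into the
  multiples of \<open>2 - i\<close> and four classes that are permuted by multiplication with \<open>i\<close>.\<close>
lemma ramanujan_phi_square:
  assumes q: "norm q < 1" "q \<noteq> 0"
  shows "(ramanujan_phi q)\<^sup>2 = (theta 1 10 5 q)\<^sup>2 + 4 * q * theta 1 10 7 q * theta 1 10 9 q"
proof -
  let ?f = "\<lambda>(m, n). q powi m\<^sup>2 * q powi n\<^sup>2"
  let ?C = "\<lambda>c. {(m, n). (m + 2 * n) mod 5 = (c::int)}"
  let ?w = "q * (theta 1 10 9 q * theta 1 10 7 q)"
  have "(?f has_sum ramanujan_phi q * ramanujan_phi q) (UNIV \<times> UNIV)"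
    using has_sum_product[OF ramanujan_phi_has_sum(2)[OF q(1)] ramanujan_phi_has_sum(2)[OF q(1)]]
    by (simp add: ramanujan_phi_def)
  moreover have UN: "(UNIV \<times> UNIV) = (\<Union>c\<in>{0..<5}. ?C c)" by (auto simp: case_prod_unfold)
  ultimately have 1: "(?f has_sum ramanujan_phi q * ramanujan_phi q) (\<Union>c\<in>{0..<5}. ?C c)" by simp
  have "((\<lambda>(a, b). q powi (5 * a\<^sup>2 + 0 * a) * q powi (5 * b\<^sup>2 + 0 * b)) has_sum
     theta 1 10 (0 + 5) q * theta 1 10 (0 + 5) q) (UNIV \<times> UNIV)"
    by (rule theta_10_product_has_sum) (use q in auto)
  also have "?this \<longleftrightarrow> (?f has_sum theta 1 10 5 q * theta 1 10 5 q) (?C 0)"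
  \<comment> \<open>\<open>(2 a + b, 2 b - a)\<close> stands for \<open>(2 - i) (a + b i)\<close>,
    of norm \<open>5 (a^2 + b^2)\<close>. The inverse reads \<open>b\<close> off
    \<open>m + 2 n = 5 b\<close> and then \<open>a = 2 b - n\<close>.\<close>
  proof (rule has_sum_reindex_bij_witness[of _ "\<lambda>(m, n). (2 * ((m + 2 * n) div 5) - n, (m + 2 * n) div 5)" "\<lambda>(a, b). (2 * a + b, 2 * b - a)"], goal_cases)
    case (1 p)
    have "2 * a + b + 2 * (2 * b - a) = 5 * b" for a b :: int by simp
    thus ?case by (auto simp: case_prod_unfold)
  next
    case (2 p)
    have "2 * a + b + 2 * (2 * b - a) = 5 * b" for a b :: int by simp
    thus ?case by (auto simp: case_prod_unfold)
  next
    case (3 p)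
    hence "5 * ((fst p + 2 * snd p) div 5) = fst p + 2 * snd p" by (auto simp: case_prod_unfold)
    thus ?case by (auto simp: case_prod_unfold prod_eq_iff)
  next
    case (5 p)
    obtain a b where p: "p = (a, b)" by force
    have "(2 * a + b)\<^sup>2 + (2 * b - a)\<^sup>2 = (5 * a\<^sup>2 + 0 * a) + (5 * b\<^sup>2 + 0 * b)"
      by (simp add: power2_eq_square algebra_simps)
    hence "q powi (2 * a + b)\<^sup>2 * q powi (2 * b - a)\<^sup>2 = q powi (5 * a\<^sup>2 + 0 * a) * q powi (5 * b\<^sup>2 + 0 * b)"
      using q by (metis power_int_add)
    thus ?case by (simp add: p)
  qed (use q in auto)
  finally have C0: "(?f has_sum theta 1 10 5 q * theta 1 10 5 q) (?C 0)" .
  have "((\<lambda>(k, l). q powi (5 * k\<^sup>2 + 4 * k) * q powi (5 * l\<^sup>2 + 2 * l)) has_sum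
     theta 1 10 (4 + 5) q * theta 1 10 (2 + 5) q) (UNIV \<times> UNIV)"
    by (rule theta_10_product_has_sum) (use q in auto)
  hence "((\<lambda>p. q * ((\<lambda>(k, l). q powi (5 * k\<^sup>2 + 4 * k) * q powi (5 * l\<^sup>2 + 2 * l)) p)) has_sum
     q * (theta 1 10 (4 + 5) q * theta 1 10 (2 + 5) q)) (UNIV \<times> UNIV)"
    by (rule has_sum_cmult_right)
  also have "?this \<longleftrightarrow> (?f has_sum ?w) (?C 1)"
  \<comment> \<open>Class 1 is the coset \<open>1 + (2 - i) (k + l i)\<close>; the added 1 produces
    the linear terms \<open>4 k\<close> and \<open>2 l\<close> and the factor
    \<open>q\<close>.\<close>
  proof (rule has_sum_reindex_bij_witness[of _ "\<lambda>(m, n). (2 * ((m + 2 * n) div 5) - n, (m + 2 * n) div 5)" "\<lambda>(k, l). (2 * k + l + 1, 2 * l - k)"], goal_cases)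
    case (1 p)
    have "2 * k + l + 1 + 2 * (2 * l - k) = 1 + 5 * l" for k l :: int by simp
    thus ?case by (auto simp: case_prod_unfold)
  next
    case (2 p)
    have "2 * k + l + 1 + 2 * (2 * l - k) = 1 + 5 * l" for k l :: int by simp
    thus ?case by (auto simp: case_prod_unfold)
  next
    case (3 p)
    hence "5 * ((fst p + 2 * snd p) div 5) = fst p + 2 * snd p - 1"
      by (auto simp: case_prod_unfold minus_mod_eq_mult_div[symmetric])
    thus ?case by (auto simp: case_prod_unfold prod_eq_iff)
  next
    case (5 p)
    obtain k l where p: "p = (k, l)" by force
    have "(2 * k + l + 1)\<^sup>2 + (2 * l - k)\<^sup>2 = 1 + ((5 * k\<^sup>2 + 4 * k) + (5 * l\<^sup>2 + 2 * l))"
      by (simp add: power2_eq_square algebra_simps)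
    hence "q powi (2 * k + l + 1)\<^sup>2 * q powi (2 * l - k)\<^sup>2 = q powi 1 * (q powi (5 * k\<^sup>2 + 4 * k) * q powi (5 * l\<^sup>2 + 2 * l))"
      using q by (metis power_int_add)
    thus ?case by (simp add: p)
  qed (use q in auto)
  finally have C1: "(?f has_sum ?w) (?C 1)" .
  \<comment> \<open>Multiplication by \<open>i\<close> sends \<open>(m, n)\<close> to
    \<open>(-n, m)\<close>, preserves the norm and doubles \<open>m + 2 n\<close> modulo 5, so the
    classes run through 1, 2, 4, 3.\<close>
  have rot: "(?f has_sum ?w) (?C c) \<longleftrightarrow> (?f has_sum ?w) (?C (2 * c mod 5))" if "c \<in> {0..<5}" for c
  proof (rule has_sum_reindex_bij_witness[of _ "\<lambda>(m, n). (n, -m)" "\<lambda>(m, n). (-n, m)"], goal_cases)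
    case (2 p)
    obtain m n where p: "p = (m, n)" by force
    have "(- n + 2 * m) mod 5 = (2 * (m + 2 * n) + (- n) * 5) mod 5" by (simp add: algebra_simps)
    also have "\<dots> = 2 * (m + 2 * n) mod 5" by (rule mod_mult_self1)
    also have "\<dots> = 2 * ((m + 2 * n) mod 5) mod 5" by (simp add: mod_mult_right_eq)
    finally show ?case using 2 by (simp add: p)
  next
    case (4 p)
    obtain m n where p: "p = (m, n)" by force
    have "(n + 2 * (- m)) mod 5 = (3 * (m + 2 * n) + (- (m + n)) * 5) mod 5" by (simp add: algebra_simps)
    also have "\<dots> = 3 * (m + 2 * n) mod 5" by (rule mod_mult_self1)
    also have "\<dots> = 3 * ((m + 2 * n) mod 5) mod 5" by (simp add: mod_mult_right_eq)
    also have "\<dots> = (c + c * 5) mod 5" using 4 by (simp add: p mod_mult_right_eq)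
    also have "\<dots> = c" using that by (simp only: mod_mult_self1) simp
    finally show ?case by (simp add: p)
  qed (auto simp: mult.commute)
  have C2: "(?f has_sum ?w) (?C 2)" using C1 rot[of 1] by simp
  have C4: "(?f has_sum ?w) (?C 4)" using C2 rot[of 2] by simp
  have C3: "(?f has_sum ?w) (?C 3)" using C4 rot[of 4] by simp
  have "(?f has_sum (\<Sum>c\<in>{0::int..<5}. if c = 0 then theta 1 10 5 q * theta 1 10 5 q else ?w)) (\<Union>c\<in>{0..<5}. ?C c)"
  proof (rule sum_has_sum)
    fix c :: int assume "c \<in> {0..<5}"
    hence "c \<in> {0, 1, 2, 3, 4}" by auto
    thus "(?f has_sum (if c = 0 then theta 1 10 5 q * theta 1 10 5 q else ?w)) (?C c)"
      using C0 C1 C2 C3 C4 by auto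
  qed auto
  from has_sum_unique[OF 1 this]
  have "ramanujan_phi q * ramanujan_phi q = (\<Sum>c\<in>{0::int..<5}. if c = 0 then theta 1 10 5 q * theta 1 10 5 q else ?w)" .
  moreover have "{0::int..<5} = {0, 1, 2, 3, 4}" by auto
  ultimately show ?thesis by (simp add: power2_eq_square)
qed

section \<open>Holomorphy and analytic continuation from the origin\<close>

lemma infsum_powi_holomorphic:
  fixes c :: "int \<Rightarrow> complex"
  assumes e: "\<And>n. \<bar>n\<bar> \<le> e n" and c: "\<And>n. norm (c n) \<le> 1"
  shows "(\<lambda>q. \<Sum>\<^sub>\<infinity>n. c n * q powi e n) holomorphic_on ball 0 1"
proof -
  let ?F = "\<lambda>q. \<Sum>\<^sub>\<infinity>n. c n * q powi e n"
  have "?F holomorphic_on ball 0 r" if r: "0 < r" "r < 1" for r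
  proof -
    \<comment> \<open>The majorant \<open>r^|n|\<close> gives uniform convergence on the closed disc
      of radius \<open>r < 1\<close>; the open discs of these radii exhaust the unit disc.\<close>
    have "uniform_limit (cball 0 r) (\<lambda>X q. \<Sum>n\<in>X. c n * q powi e n) ?F (finite_subsets_at_top UNIV)"
    proof (rule Weierstrass_m_test_general)
      fix n and q :: complex assume "q \<in> cball 0 r"
      hence qr: "norm q \<le> r" by simp
      have "norm (c n * q powi e n) \<le> 1 * norm q ^ nat \<bar>n\<bar>"
        unfolding norm_mult using c[of n] norm_powi_le[of q n "e n"] e[of n] qr r
        by (intro mult_mono) auto
      also have "\<dots> \<le> r ^ nat \<bar>n\<bar>" using qr by (simp add: power_mono)
      finally show "norm (c n * q powi e n) \<le> r ^ nat \<bar>n\<bar>" .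
    next
      show "(\<lambda>n. r ^ nat \<bar>n\<bar>) summable_on (UNIV :: int set)"
        using r by (intro summable_on_int_power_abs) auto
    qed
    moreover have "\<forall>\<^sub>F X in finite_subsets_at_top UNIV. continuous_on (cball 0 r) (\<lambda>q. \<Sum>n\<in>X. c n * q powi e n)
       \<and> (\<lambda>q. \<Sum>n\<in>X. c n * q powi e n) holomorphic_on ball 0 r"
    proof (intro always_eventually allI)
      fix X
      have "q powi e n = q ^ nat (e n)" for q :: complex and n
        using e[of n] by (simp add: power_int_def)
      hence "(\<lambda>q. \<Sum>n\<in>X. c n * q powi e n) holomorphic_on UNIV"
        by (simp add: holomorphic_intros)
      thus "continuous_on (cball 0 r) (\<lambda>q. \<Sum>n\<in>X. c n * q powi e n)
       \<and> (\<lambda>q. \<Sum>n\<in>X. c n * q powi e n) holomorphic_on ball 0 r"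
        by (meson holomorphic_on_imp_continuous_on holomorphic_on_subset subset_UNIV)
    qed
    ultimately show ?thesis
      using holomorphic_uniform_limit[of 0 r "\<lambda>X q. \<Sum>n\<in>X. c n * q powi e n" "finite_subsets_at_top UNIV" ?F] by auto
  qed
  hence *: "?F holomorphic_on (\<Union>r\<in>{0<..<1}. ball 0 r)"
    by (intro holomorphic_on_UN_open) auto
  have "ball (0::complex) 1 \<subseteq> (\<Union>r\<in>{0<..<1}. ball 0 r)"
  proof
    fix z :: complex assume "z \<in> ball 0 1"
    hence "norm z < (norm z + 1) / 2" "(norm z + 1) / 2 < 1" by simp_all
    moreover have "0 < (norm z + 1) / 2" by (simp add: add_nonneg_pos)
    ultimately show "z \<in> (\<Union>r\<in>{0<..<1}. ball 0 r)"
      by (intro UN_I[of "(norm z + 1) / 2"]) auto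
  qed
  thus ?thesis using * holomorphic_on_subset by blast
qed

lemma theta_holomorphic:
  assumes "0 < b" "b < a" "norm c = 1"
  shows "theta c a b holomorphic_on ball 0 1"
  unfolding theta_def[abs_def]
  using assms theta_exponent_ge by (intro infsum_powi_holomorphic) (auto simp: norm_power_int)

lemma ramanujan_phi_holomorphic: "ramanujan_phi holomorphic_on ball 0 1"
  using infsum_powi_holomorphic[OF abs_le_square, of "\<lambda>_. 1"]
  by (simp add: ramanujan_phi_def[abs_def])

lemma infsum_powi_at_0:
  fixes c :: "int \<Rightarrow> complex"
  assumes e: "\<And>n. \<bar>n\<bar> \<le> e n" "e 0 = 0"
  shows "(\<Sum>\<^sub>\<infinity>n. c n * 0 powi e n) = c 0"
proof -
  have "e n \<noteq> 0" if "n \<noteq> 0" for n using e(1)[of n] that by auto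
  hence "(\<Sum>\<^sub>\<infinity>n. c n * 0 powi e n) = (\<Sum>\<^sub>\<infinity>n\<in>{0}. c n * 0 powi e n)"
    by (intro infsum_cong_neutral) auto
  thus ?thesis using e by simp
qed

lemma theta_at_0: "0 < b \<Longrightarrow> b < a \<Longrightarrow> theta c a b 0 = 1"
  unfolding theta_def using theta_exponent_ge[of b a] by (subst infsum_powi_at_0) auto

lemma ramanujan_phi_at_0: "ramanujan_phi 0 = 1"
  unfolding ramanujan_phi_def using infsum_powi_at_0[of "\<lambda>n. n\<^sup>2" "\<lambda>_. 1"] abs_le_square by simp

text \<open>Both sides have the same square, so one of their difference and their sum vanishes at every
  point; the sum is nonzero near 0, and analytic continuation selects the difference.\<close>
lemma theta_three_term':
  assumes "norm q < 1"
  shows "theta 1 10 9 q * (theta (-1) 20 12 q)\<^sup>2 + q * theta 1 10 7 q * (theta (-1) 20 16 q)\<^sup>2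
           = ramanujan_phi q * theta (-1) 20 12 q * theta (-1) 20 16 q"
proof -
  define F where "F = (\<lambda>q. theta 1 10 9 q * (theta (-1) 20 12 q)\<^sup>2 + q * theta 1 10 7 q * (theta (-1) 20 16 q)\<^sup>2)"
  define K where "K = (\<lambda>q. ramanujan_phi q * theta (-1) 20 12 q * theta (-1) 20 16 q)"
  have F: "F holomorphic_on ball 0 1"
    unfolding F_def by (intro holomorphic_intros theta_holomorphic) auto
  have K: "K holomorphic_on ball 0 1"
    unfolding K_def by (intro holomorphic_intros theta_holomorphic ramanujan_phi_holomorphic) auto
  have at0: "F 0 = 1" "K 0 = 1"
    by (simp_all add: F_def K_def theta_at_0 ramanujan_phi_at_0)
  have sq: "(F q - K q) * (F q + K q) = 0" if "norm q < 1" for q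
  proof (cases "q = 0")
    case False
    define S where "S = theta 1 10 9 q * (theta (-1) 20 12 q)\<^sup>2"
    define T where "T = q * theta 1 10 7 q * (theta (-1) 20 16 q)\<^sup>2"
    have ST: "S - T = theta 1 10 5 q * theta (-1) 20 12 q * theta (-1) 20 16 q"
      unfolding S_def T_def by (rule theta_three_term[OF that False])
    \<comment> \<open>\<open>F\<close> is \<open>S + T\<close>, whereas the three-term relation
      controls \<open>S - T\<close>. The correction \<open>4 S T\<close> is
      \<open>4 q theta7 theta9 (g h)^2\<close> with \<open>g\<close>, \<open>h\<close> of indices 12
      and 16, exactly the extra term in the formula for \<open>phi^2\<close>.\<close>
    have "(F q)\<^sup>2 = (S - T)\<^sup>2 + 4 * S * T"
      by (simp add: F_def S_def T_def power2_eq_square algebra_simps)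
    also have "\<dots> = ((theta 1 10 5 q)\<^sup>2 + 4 * q * theta 1 10 7 q * theta 1 10 9 q) * (theta (-1) 20 12 q * theta (-1) 20 16 q)\<^sup>2"
      unfolding ST by (simp add: S_def T_def power2_eq_square algebra_simps)
    also have "\<dots> = (K q)\<^sup>2"
      unfolding ramanujan_phi_square[OF that False, symmetric] by (simp add: K_def power_mult_distrib)
    finally show ?thesis by (simp add: power2_eq_square algebra_simps)
  qed (use at0 in simp)
  define U where "U = {q \<in> ball 0 1. F q + K q \<in> - {0}}"
  have U: "open U"
    unfolding U_def
    by (rule continuous_open_preimage[unfolded vimage_def Int_def mem_Collect_eq])
       (use F K in \<open>auto intro!: holomorphic_on_imp_continuous_on holomorphic_intros\<close>)
  have U0: "0 \<in> U" by (simp add: U_def at0)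
  have UFK: "F z = K z" if "z \<in> U" for z
    using that sq[of z] by (auto simp: U_def)
  have "F q = K q"
  proof (rule analytic_continuation_open[OF U open_ball _ _ _ F K UFK])
    show "U \<noteq> {}" using U0 by blast
    show "U \<subseteq> ball 0 1" by (auto simp: U_def)
  qed (use assms in auto)
  thus ?thesis by (simp add: F_def K_def)
qed

text \<open>With \<open>X = E2 G G4\<close> and \<open>Y = q E2 H H4\<close> the product formulas
  give \<open>theta9 g = X h\<close> and \<open>q theta7 h = Y g\<close>, so the two three-term
  relations become formulas for \<open>(X + Y) g h\<close> and \<open>(X - Y) g h\<close>; the
  nonzero \<open>g h\<close> cancels.\<close>

lemma
  assumes q: "norm q < 1" "q \<noteq> 0"
  shows ramanujan_phi_RR:
      "ramanujan_phi q = euler_E (q ^ 2) * RR_G q * RR_G (q ^ 4) + q * (euler_E (q ^ 2) * RR_H q * RR_H (q ^ 4))" (is ?A)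
    and ramanujan_phi_5_RR:
      "ramanujan_phi (q ^ 5) = euler_E (q ^ 2) * RR_G q * RR_G (q ^ 4) - q * (euler_E (q ^ 2) * RR_H q * RR_H (q ^ 4))" (is ?B)
proof -
  define g h where "g = theta (-1) 20 12 q" and "h = theta (-1) 20 16 q"
  have nz: "g \<noteq> 0" "h \<noteq> 0"
    unfolding g_def h_def using theta_neg_nonzero[OF q, of 12 20] theta_neg_nonzero[OF q, of 16 20] by simp_all
  have q4: "norm (q ^ 4) < 1" "q ^ 4 \<noteq> 0" using q norm_power_less_1[of q 4] by auto
  have g: "g = euler_E (q ^ 4) * RR_G (q ^ 4)"
    using euler_E_RR_G[OF q4] q by (simp add: theta_power g_def)
  have h: "h = euler_E (q ^ 4) * RR_H (q ^ 4)"
    using euler_E_RR_H[OF q4] q by (simp add: theta_power h_def)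
  define X Y where "X = euler_E (q ^ 2) * RR_G q * RR_G (q ^ 4)"
    and "Y = q * (euler_E (q ^ 2) * RR_H q * RR_H (q ^ 4))"
  have X: "theta 1 10 9 q * g = X * h" and Y: "q * theta 1 10 7 q * h = Y * g"
    unfolding euler_E_RR_G_H[OF q, symmetric] euler_E_RR_H_G[OF q, symmetric] X_def Y_def g h by simp_all
  have "(X + Y) * (g * h) = ramanujan_phi q * (g * h)"
    using theta_three_term'[OF q(1)] X Y
    by (simp add: power2_eq_square algebra_simps flip: g_def h_def)
  thus ?A unfolding X_def[symmetric] Y_def[symmetric] using nz by simp
  have "(X - Y) * (g * h) = theta 1 10 5 q * (g * h)"
    using theta_three_term[OF q] X Y
    by (simp add: power2_eq_square algebra_simps flip: g_def h_def)
  thus ?B unfolding X_def[symmetric] Y_def[symmetric] using nz ramanujan_phi_5[OF q(1)] by simp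
qed

section \<open>The Hecke operator on products of theta functions\<close>

text \<open>Grouping by exponent turns a series over lattice points into a power series whose
  coefficients count them.\<close>

lemma power_family_sums:
  fixes e :: "'i \<Rightarrow> nat" and q :: complex
  assumes s: "\<And>x::real. 0 \<le> x \<Longrightarrow> x < 1 \<Longrightarrow> (\<lambda>i. x ^ e i) summable_on I" and q: "norm q < 1"
  shows "(\<lambda>k. of_nat (card {i \<in> I. e i = k}) * q ^ k) sums (\<Sum>\<^sub>\<infinity>i\<in>I. q ^ e i)"
proof -
  \<comment> \<open>An infinite fibre would make the constant \<open>(1/2)^k\<close> summable over
    an infinite set.\<close>
  have fin: "finite {i \<in> I. e i = k}" for k
  proof (rule ccontr)
    assume inf: "infinite {i \<in> I. e i = k}"
    have "(\<lambda>i. (1/2::real) ^ e i) summable_on {i \<in> I. e i = k}"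
      by (rule summable_on_subset_banach[OF s]) auto
    hence "(\<lambda>_. (1/2::real) ^ k) summable_on {i \<in> I. e i = k}"
      by (rule summable_on_cong[THEN iffD1, rotated]) auto
    thus False using infsum_diverge_constant[OF inf, of "(1/2::real) ^ k"] by simp
  qed
  have "(\<lambda>i. norm (q ^ e i)) summable_on I"
    using s[of "norm q"] q by (simp add: norm_power)
  hence "((\<lambda>i. q ^ e i) has_sum (\<Sum>\<^sub>\<infinity>i\<in>I. q ^ e i)) I"
    by (rule has_sum_infsum[OF Infinite_Sum.abs_summable_summable])
  also have "?this \<longleftrightarrow> ((\<lambda>(k, i). q ^ k) has_sum (\<Sum>\<^sub>\<infinity>i\<in>I. q ^ e i)) (Sigma UNIV (\<lambda>k. {i \<in> I. e i = k}))"
    by (rule has_sum_reindex_bij_witness[of _ snd "\<lambda>i. (e i, i)"]) auto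
  finally have "((\<lambda>k. of_nat (card {i \<in> I. e i = k}) * q ^ k) has_sum (\<Sum>\<^sub>\<infinity>i\<in>I. q ^ e i)) UNIV"
    by (rule has_sum_SigmaD) (auto intro!: has_sum_finiteI fin)
  thus ?thesis by (rule has_sum_imp_sums)
qed

text \<open>\<open>T5\<close> acts on Taylor coefficients at 0, so these must be identified as the
  counting coefficients; convergence at \<open>1/2\<close> gives a positive radius.\<close>

lemma power_family_fps_expansion:
  fixes e :: "'i \<Rightarrow> nat" and f :: "complex \<Rightarrow> complex"
  assumes s: "\<And>x::real. 0 \<le> x \<Longrightarrow> x < 1 \<Longrightarrow> (\<lambda>i. x ^ e i) summable_on I"
    and f: "\<And>x. norm x < 1 \<Longrightarrow> f x = (\<Sum>\<^sub>\<infinity>i\<in>I. x ^ e i)"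
  shows "f has_fps_expansion Abs_fps (\<lambda>k. of_nat (card {i \<in> I. e i = k}))"
proof -
  let ?F = "Abs_fps (\<lambda>k. of_nat (card {i \<in> I. e i = k})) :: complex fps"
  have "summable (\<lambda>k. fps_nth ?F k * (1/2) ^ k)"
    using power_family_sums[OF s, of "1/2"] by (simp add: sums_iff)
  hence "ereal (norm (1/2::complex)) \<le> fps_conv_radius ?F"
    unfolding fps_conv_radius_def by (rule conv_radius_geI)
  moreover have "ereal 0 < ereal (norm (1/2::complex))" by simp
  ultimately have "fps_conv_radius ?F > 0" unfolding zero_ereal_def by (rule order.strict_trans2[rotated])
  moreover have "\<forall>\<^sub>F z in nhds 0. eval_fps ?F z = f z"
  proof (rule eventually_nhds_in_open[of "ball 0 1", THEN eventually_mono])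
    fix z :: complex assume "z \<in> ball 0 1"
    hence "norm z < 1" by simp
    thus "eval_fps ?F z = f z"
      using power_family_sums[OF s, of z] by (simp add: eval_fps_def f sums_iff)
  qed auto
  ultimately show ?thesis by (simp add: has_fps_expansion_def)
qed

text \<open>On exponents, \<open>a(5 n)\<close> keeps those divisible by 5 and divides them by 5,
  while \<open>a(n / 5)\<close> multiplies all of them by 5.\<close>

lemma T5_power_family:
  fixes e :: "'i \<Rightarrow> nat"
  assumes s: "\<And>x::real. 0 \<le> x \<Longrightarrow> x < 1 \<Longrightarrow> (\<lambda>i. x ^ e i) summable_on UNIV"
    and f: "\<And>x. norm x < 1 \<Longrightarrow> f x = (\<Sum>\<^sub>\<infinity>i. x ^ e i)" and q: "norm q < 1"
  shows "T5 f q = (\<Sum>\<^sub>\<infinity>i\<in>{i. 5 dvd e i}. q ^ (e i div 5)) + (\<Sum>\<^sub>\<infinity>i. q ^ (5 * e i))"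
proof -
  let ?a = "\<lambda>k. of_nat (card {i. e i = k}) :: complex"
  have F: "fps_expansion f 0 = Abs_fps ?a"
    using fps_expansion_eqI[OF power_family_fps_expansion[OF s f]] by simp
  have "(\<lambda>k. of_nat (card {i \<in> {i. 5 dvd e i}. e i div 5 = k}) * q ^ k) sums (\<Sum>\<^sub>\<infinity>i\<in>{i. 5 dvd e i}. q ^ (e i div 5))"
  proof (rule power_family_sums[OF _ q])
    fix x :: real assume x: "0 \<le> x" "x < 1"
    \<comment> \<open>Summability of the divided exponents at \<open>x\<close> is that of the
      original ones at the fifth root of \<open>x\<close>.\<close>
    have "(\<lambda>i. root 5 x ^ e i) summable_on {i. 5 dvd e i}"
      by (rule summable_on_subset_banach[OF s]) (use x in auto)
    also have "?this \<longleftrightarrow> (\<lambda>i. x ^ (e i div 5)) summable_on {i. 5 dvd e i}"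
    proof (rule summable_on_cong)
      fix i assume "i \<in> {i. 5 dvd e i}"
      hence "e i = 5 * (e i div 5)" by simp
      hence "root 5 x ^ e i = (root 5 x ^ 5) ^ (e i div 5)" by (metis power_mult)
      thus "root 5 x ^ e i = x ^ (e i div 5)" using x by simp
    qed
    finally show "(\<lambda>i. x ^ (e i div 5)) summable_on {i. 5 dvd e i}" .
  qed
  moreover have "{i \<in> {i. 5 dvd e i}. e i div 5 = k} = {i. e i = 5 * k}" for k by auto
  ultimately have 1: "(\<lambda>k. ?a (5 * k) * q ^ k) sums (\<Sum>\<^sub>\<infinity>i\<in>{i. 5 dvd e i}. q ^ (e i div 5))" by simp
  have "(\<lambda>k. of_nat (card {i \<in> UNIV. 5 * e i = k}) * q ^ k) sums (\<Sum>\<^sub>\<infinity>i. q ^ (5 * e i))"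
  proof (rule power_family_sums[OF _ q])
    fix x :: real assume x: "0 \<le> x" "x < 1"
    show "(\<lambda>i. x ^ (5 * e i)) summable_on UNIV"
      unfolding power_mult using x by (intro s) (auto simp: power_less_one_iff)
  qed
  moreover have "of_nat (card {i \<in> UNIV. 5 * e i = k}) = (if 5 dvd k then ?a (k div 5) else 0)" for k
  proof (cases "5 dvd k")
    case True
    hence "{i \<in> UNIV. 5 * e i = k} = {i. e i = k div 5}" by auto
    thus ?thesis using True by simp
  next
    case False
    hence "{i \<in> UNIV. 5 * e i = k} = {}" by auto
    thus ?thesis using False by simp
  qed
  ultimately have 2: "(\<lambda>k. (if 5 dvd k then ?a (k div 5) else 0) * q ^ k) sums (\<Sum>\<^sub>\<infinity>i. q ^ (5 * e i))" by simp
  have nth: "fps_nth (T5_series (fps_expansion f 0)) k = ?a (5 * k) + (if 5 dvd k then ?a (k div 5) else 0)" for k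
    by (auto simp: T5_series_def F)
  from sums_add[OF 1 2] show ?thesis
    unfolding T5_def eval_fps_def nth by (simp add: sums_iff distrib_right)
qed

section \<open>Residue classes of the form \<open>r m^2 + s n^2\<close> modulo 5\<close>

lemma theta_10_reflect: "theta 1 10 (5 - b) q = theta 1 10 (5 + b) q"
  unfolding theta_def
proof (rule infsum_reindex_bij_witness[of _ uminus uminus], goal_cases)
  case (5 n)
  have "10 * tri (-n) + (5 + b) * (-n) = 10 * tri n + (5 - b) * n"
    using two_tri[of n] two_tri[of "-n"] by (simp add: algebra_simps)
  thus ?case by simp
qed auto

lemma power_nat_quadratic:
  fixes q :: complex
  assumes "q \<noteq> 0"
  shows "q ^ nat (int r * m\<^sup>2 + int s * n\<^sup>2) = (q ^ r) powi m\<^sup>2 * (q ^ s) powi n\<^sup>2"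
proof -
  have "q ^ nat (int r * m\<^sup>2 + int s * n\<^sup>2) = q powi (int r * m\<^sup>2 + int s * n\<^sup>2)"
    by (simp add: power_int_def)
  thus ?thesis using assms by (simp add: power_int_add power_int_mult)
qed

lemma phi_phi_eq_infsum:
  assumes r: "r > 0" and s: "s > 0" and q: "norm q < 1"
  shows "ramanujan_phi (q ^ r) * ramanujan_phi (q ^ s)
           = (\<Sum>\<^sub>\<infinity>(m, n). q ^ nat (int r * m\<^sup>2 + int s * n\<^sup>2))"
    and "(\<lambda>(m, n). norm (q ^ nat (int r * m\<^sup>2 + int s * n\<^sup>2))) summable_on UNIV"
proof -
  have qr: "norm (q ^ r) < 1" "norm (q ^ s) < 1" using norm_power_less_1 assms by auto
  have "q ^ nat (int r * m\<^sup>2 + int s * n\<^sup>2) = (q ^ r) powi m\<^sup>2 * (q ^ s) powi n\<^sup>2" for m n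
  proof (cases "q = 0")
    \<comment> \<open>At \<open>q = 0\<close> positive definiteness of the form leaves only the term
      at the origin on either side.\<close>
    case True
    have "0 < int r * m\<^sup>2 + int s * n\<^sup>2" if "m \<noteq> 0 \<or> n \<noteq> 0"
      using that r s by (auto intro: add_pos_nonneg add_nonneg_pos)
    thus ?thesis using True r s by (cases "m = 0"; cases "n = 0") (auto simp: power_0_left mult_le_0_iff)
  qed (rule power_nat_quadratic)
  note eq = this
  show "ramanujan_phi (q ^ r) * ramanujan_phi (q ^ s)
           = (\<Sum>\<^sub>\<infinity>(m, n). q ^ nat (int r * m\<^sup>2 + int s * n\<^sup>2))"
    using has_sum_product[OF ramanujan_phi_has_sum(2)[OF qr(1)] ramanujan_phi_has_sum(2)[OF qr(2)]]
    by (simp add: eq ramanujan_phi_def infsumI)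
  show "(\<lambda>(m, n). norm (q ^ nat (int r * m\<^sup>2 + int s * n\<^sup>2))) summable_on UNIV"
    using abs_summable_on_product[OF ramanujan_phi_has_sum(2)[OF qr(1)] ramanujan_phi_has_sum(2)[OF qr(2)]]
    by (simp add: eq)
qed

text \<open>Modulo 5, \<open>s = -r\<close> and the form is \<open>r (m - n) (m + n)\<close> with
  \<open>r\<close> invertible.\<close>

lemma dvd_quadratic_iff:
  fixes m n r s :: int
  assumes rs: "5 dvd r + s" and r: "\<not> 5 dvd r"
  shows "5 dvd r * m\<^sup>2 + s * n\<^sup>2 \<longleftrightarrow> 5 dvd m - n \<or> 5 dvd m + n"
proof -
  have "r * m\<^sup>2 + s * n\<^sup>2 = (r + s) * n\<^sup>2 + r * ((m - n) * (m + n))"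
    by (simp add: power2_eq_square algebra_simps)
  also have "5 dvd \<dots> \<longleftrightarrow> 5 dvd r * ((m - n) * (m + n))"
    using rs by (intro dvd_add_right_iff) simp
  also have "\<dots> \<longleftrightarrow> 5 dvd m - n \<or> 5 dvd m + n"
    using r prime_dvd_mult_iff[of "5::int"] by simp
  finally show ?thesis .
qed

text \<open>On the class \<open>(5 k + a, 5 l + b)\<close> with \<open>b^2 = a^2\<close> the form
  divided by 5 is \<open>t a^2 + r (5 k^2 + 2 a k) + s (5 l^2 + 2 b l)\<close>, so the sum factors
  into two theta functions.\<close>

lemma quadratic_class_has_sum:
  fixes q :: complex
  assumes r: "r > 0" and s: "s > 0" and q: "norm q < 1" "q \<noteq> 0" and rs: "r + s = 5 * t"
    and ab: "\<bar>a\<bar> \<le> 2" "b = a \<or> b = -a"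
  shows "((\<lambda>(m, n). q ^ (nat (int r * m\<^sup>2 + int s * n\<^sup>2) div 5)) has_sum
            q ^ (t * nat (a\<^sup>2)) * (theta 1 10 (5 + 2 * \<bar>a\<bar>) (q ^ r) * theta 1 10 (5 + 2 * \<bar>a\<bar>) (q ^ s)))
            (range (\<lambda>(k, l). (5 * k + a, 5 * l + b)))"
proof -
  have qr: "norm (q ^ r) < 1" "norm (q ^ s) < 1" using norm_power_less_1 assms by auto
  \<comment> \<open>Reflection removes the signs of \<open>a\<close> and \<open>b\<close>, so that
    only \<open>|a|\<close> enters the value.\<close>
  have th: "theta 1 10 (2 * c + 5) x = theta 1 10 (5 + 2 * \<bar>a\<bar>) x" if "c = a \<or> c = -a" for c x
    using that theta_10_reflect[of "2 * a" x] by (cases "a \<ge> 0") (auto simp: add.commute)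
  have b: "b\<^sup>2 = a\<^sup>2" and la: "-5 < 2 * a" "2 * a < 5" and lb: "-5 < 2 * b" "2 * b < 5" using ab by auto
  have "((\<lambda>(k, l). (q ^ r) powi (5 * k\<^sup>2 + (2 * a) * k) * (q ^ s) powi (5 * l\<^sup>2 + (2 * b) * l)) has_sum
      theta 1 10 (2 * a + 5) (q ^ r) * theta 1 10 (2 * b + 5) (q ^ s)) (UNIV \<times> UNIV)"
    using has_sum_product[OF theta_10_has_sum(2)[OF qr(1) la] theta_10_has_sum(2)[OF qr(2) lb]]
    unfolding infsumI[OF theta_10_has_sum(1)[OF qr(1) la]] infsumI[OF theta_10_has_sum(1)[OF qr(2) lb]] .
  hence "((\<lambda>p. q ^ (t * nat (a\<^sup>2)) * ((\<lambda>(k, l). (q ^ r) powi (5 * k\<^sup>2 + (2 * a) * k) * (q ^ s) powi (5 * l\<^sup>2 + (2 * b) * l)) p)) has_sum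
      q ^ (t * nat (a\<^sup>2)) * (theta 1 10 (2 * a + 5) (q ^ r) * theta 1 10 (2 * b + 5) (q ^ s))) UNIV"
    unfolding UNIV_Times_UNIV by (rule has_sum_cmult_right)
  also have "theta 1 10 (2 * a + 5) (q ^ r) = theta 1 10 (5 + 2 * \<bar>a\<bar>) (q ^ r)" by (rule th) simp
  also have "theta 1 10 (2 * b + 5) (q ^ s) = theta 1 10 (5 + 2 * \<bar>a\<bar>) (q ^ s)" by (rule th) (use ab in auto)
  finally have *: "((\<lambda>p. q ^ (t * nat (a\<^sup>2)) * ((\<lambda>(k, l). (q ^ r) powi (5 * k\<^sup>2 + (2 * a) * k) * (q ^ s) powi (5 * l\<^sup>2 + (2 * b) * l)) p)) has_sum
      q ^ (t * nat (a\<^sup>2)) * (theta 1 10 (5 + 2 * \<bar>a\<bar>) (q ^ r) * theta 1 10 (5 + 2 * \<bar>a\<bar>) (q ^ s))) UNIV" .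
  have inj: "inj (\<lambda>(k, l). (5 * k + a, 5 * l + b))" by (auto simp: inj_on_def)
  have eq: "q ^ (nat (int r * (5 * k + a)\<^sup>2 + int s * (5 * l + b)\<^sup>2) div 5)
     = q ^ (t * nat (a\<^sup>2)) * ((q ^ r) powi (5 * k\<^sup>2 + (2 * a) * k) * (q ^ s) powi (5 * l\<^sup>2 + (2 * b) * l))" for k l
  proof -
    have "int r * (5 * k + a)\<^sup>2 + int s * (5 * l + b)\<^sup>2 =
      5 * (int r * (5 * k\<^sup>2 + (2 * a) * k) + int s * (5 * l\<^sup>2 + (2 * b) * l)) + int (r + s) * a\<^sup>2"
      using b by (simp add: power2_eq_square algebra_simps)
    also have "\<dots> = 5 * (int t * a\<^sup>2 + (int r * (5 * k\<^sup>2 + (2 * a) * k) + int s * (5 * l\<^sup>2 + (2 * b) * l)))"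
      unfolding rs by (simp add: algebra_simps)
    finally have E: "int r * (5 * k + a)\<^sup>2 + int s * (5 * l + b)\<^sup>2 =
       5 * (int t * a\<^sup>2 + (int r * (5 * k\<^sup>2 + (2 * a) * k) + int s * (5 * l\<^sup>2 + (2 * b) * l)))" (is "_ = 5 * ?x") .
    have "0 \<le> int r * (5 * k + a)\<^sup>2 + int s * (5 * l + b)\<^sup>2" by simp
    hence x0: "?x \<ge> 0" unfolding E by simp
    have "nat (5 * ?x) div 5 = nat ?x" using x0 by (simp add: nat_mult_distrib)
    hence "q ^ (nat (int r * (5 * k + a)\<^sup>2 + int s * (5 * l + b)\<^sup>2) div 5) = q powi ?x"
      unfolding E using x0 by (simp add: power_int_def)
    also have "\<dots> = q powi (int t * a\<^sup>2) * (q powi (int r * (5 * k\<^sup>2 + (2 * a) * k)) * q powi (int s * (5 * l\<^sup>2 + (2 * b) * l)))"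
      using q by (simp only: power_int_add[of q, OF disjI1[OF q(2)]])
    also have "q powi (int t * a\<^sup>2) = q ^ (t * nat (a\<^sup>2))"
      by (simp add: power_int_def nat_mult_distrib)
    finally show ?thesis by (simp only: power_int_mult power_int_of_nat)
  qed
  show ?thesis
    unfolding has_sum_reindex[OF inj] using * by (simp add: o_def case_prod_unfold eq)
qed

text \<open>Nine classes are divisible by 5: the origin class, four with \<open>|a| = 1\<close> of
  weight \<open>q^t\<close>, and four with \<open>|a| = 2\<close> of weight \<open>q^(4 t)\<close>.
  The multiplied exponents give \<open>phi(q^(5 r)) phi(q^(5 s))\<close>, equal to the origin class,
  whence the coefficient 2.\<close>

lemma T5_phi_phi:
  fixes q :: complex
  assumes r: "r > 0" "\<not> 5 dvd r" and s: "s > 0" and q: "norm q < 1" "q \<noteq> 0" and rs: "r + s = 5 * t"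
  shows "T5 (\<lambda>x. ramanujan_phi (x ^ r) * ramanujan_phi (x ^ s)) q
           = 2 * (theta 1 10 5 (q ^ r) * theta 1 10 5 (q ^ s))
             + 4 * (q ^ t * (theta 1 10 7 (q ^ r) * theta 1 10 7 (q ^ s)))
             + 4 * (q ^ (4 * t) * (theta 1 10 9 (q ^ r) * theta 1 10 9 (q ^ s)))"
proof -
  define e where "e = (\<lambda>(m, n). nat (int r * m\<^sup>2 + int s * n\<^sup>2))"
  have T: "T5 (\<lambda>x. ramanujan_phi (x ^ r) * ramanujan_phi (x ^ s)) q
    = (\<Sum>\<^sub>\<infinity>i\<in>{i. 5 dvd e i}. q ^ (e i div 5)) + (\<Sum>\<^sub>\<infinity>i. q ^ (5 * e i))"
  proof (rule T5_power_family[OF _ _ q(1)])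
    fix x :: real assume "0 \<le> x" "x < 1"
    thus "(\<lambda>i. x ^ e i) summable_on UNIV"
      using phi_phi_eq_infsum(2)[OF r(1) s, of "of_real x"]
      by (simp add: e_def case_prod_unfold norm_power)
  next
    fix x :: complex assume "norm x < 1"
    thus "ramanujan_phi (x ^ r) * ramanujan_phi (x ^ s) = (\<Sum>\<^sub>\<infinity>i. x ^ e i)"
      using phi_phi_eq_infsum(1)[OF r(1) s, of x] by (simp add: e_def case_prod_unfold)
  qed
  have "(\<Sum>\<^sub>\<infinity>i. q ^ (5 * e i)) = ramanujan_phi ((q ^ 5) ^ r) * ramanujan_phi ((q ^ 5) ^ s)"
    using phi_phi_eq_infsum(1)[OF r(1) s, of "q ^ 5"] norm_power_less_1[OF q(1), of 5]
    by (simp add: e_def case_prod_unfold power_mult)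
  also have "\<dots> = theta 1 10 5 (q ^ r) * theta 1 10 5 (q ^ s)"
    using ramanujan_phi_5 norm_power_less_1[OF q(1)] r s
    by (simp add: power_commutes power_mult[symmetric] mult.commute[of 5])
       (simp add: power_mult)
  finally have 2: "(\<Sum>\<^sub>\<infinity>i. q ^ (5 * e i)) = theta 1 10 5 (q ^ r) * theta 1 10 5 (q ^ s)" .
  let ?P = "{(0, 0), (1, 1), (1, -1), (-1, 1), (-1, -1), (2, 2), (2, -2), (-2, 2), (-2, -2)} :: (int \<times> int) set"
  let ?C = "\<lambda>p. range (\<lambda>(k, l). (5 * k + fst p, 5 * l + snd p))"
  let ?w = "\<lambda>p. q ^ (t * nat ((fst p)\<^sup>2)) * (theta 1 10 (5 + 2 * \<bar>fst p\<bar>) (q ^ r) * theta 1 10 (5 + 2 * \<bar>fst p\<bar>) (q ^ s))"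
  have "((\<lambda>i. q ^ (e i div 5)) has_sum (\<Sum>p\<in>?P. ?w p)) (\<Union>p\<in>?P. ?C p)"
  proof (rule sum_has_sum)
    fix p assume p: "p \<in> ?P"
    hence "\<bar>fst p\<bar> \<le> 2" "snd p = fst p \<or> snd p = - fst p" by auto
    from quadratic_class_has_sum[OF r(1) s q rs this]
    show "((\<lambda>i. q ^ (e i div 5)) has_sum ?w p) (?C p)" by (simp add: e_def case_prod_unfold)
  next
    fix p p' assume p: "p \<in> ?P" "p' \<in> ?P" "p \<noteq> p'"
    have "fst p = fst p' \<and> snd p = snd p'"
      if "5 * k + fst p = 5 * k' + fst p'" "5 * l + snd p = 5 * l' + snd p'" for k k' l l'
    proof -
      \<comment> \<open>Residues in the interval from -2 to 2 differ by less than 5, so distinct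
        representatives give disjoint classes.\<close>
      have "x = x'" if "5 * j + x = 5 * j' + x'" "\<bar>x\<bar> \<le> 2" "\<bar>x'\<bar> \<le> 2" for j j' x x' :: int
        using that by arith
      moreover have "\<bar>fst p\<bar> \<le> 2" "\<bar>fst p'\<bar> \<le> 2" "\<bar>snd p\<bar> \<le> 2" "\<bar>snd p'\<bar> \<le> 2" using p by auto
      ultimately show ?thesis using that by blast
    qed
    thus "?C p \<inter> ?C p' = {}" using p(3) by (auto simp: prod_eq_iff)
  qed simp
  also have "(\<Union>p\<in>?P. ?C p) = {i. 5 dvd e i}"
  proof (rule set_eqI)
    fix i :: "int \<times> int"
    obtain m n where i: "i = (m, n)" by force
    have "5 dvd e i \<longleftrightarrow> 5 dvd int r * m\<^sup>2 + int s * n\<^sup>2"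
      unfolding e_def i by (simp flip: int_dvd_int_iff)
    also have "\<dots> \<longleftrightarrow> 5 dvd m - n \<or> 5 dvd m + n"
    proof (rule dvd_quadratic_iff)
      have "int r + int s = 5 * int t" using rs by linarith
      thus "5 dvd int r + int s" by simp
      show "\<not> 5 dvd int r" using r(2) by presburger
    qed
    also have "\<dots> \<longleftrightarrow> i \<in> (\<Union>p\<in>?P. ?C p)"
    proof
      assume L: "5 dvd m - n \<or> 5 dvd m + n"
      \<comment> \<open>The balanced residue of \<open>m\<close>, between -2 and 2, to match the
        representatives in \<open>?P\<close>.\<close>
      define a where "a = (m + 2) mod 5 - 2"
      define k where "k = (m + 2) div 5"
      have m: "m = 5 * k + a" unfolding a_def k_def by presburger
      have "0 \<le> (m + 2) mod 5" "(m + 2) mod 5 < 5" by simp_all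
      hence a: "a \<in> {-2, -1, 0, 1, 2}" unfolding a_def by auto
      from L obtain b l where b: "b = a \<or> b = -a" and n: "n = 5 * l + b"
      proof
        assume "5 dvd m - n"
        then obtain j where "m - n = 5 * j" by blast
        thus ?thesis using that[of a "k - j"] m by simp
      next
        assume "5 dvd m + n"
        then obtain j where "m + n = 5 * j" by blast
        thus ?thesis using that[of "-a" "j - k"] m by simp
      qed
      have "(a, b) \<in> ?P" using a b by (elim insertE) auto
      thus "i \<in> (\<Union>p\<in>?P. ?C p)"
        unfolding i using m n by (intro UN_I[of "(a, b)"] range_eqI[of _ _ "(k, l)"]) simp_all
    next
      assume "i \<in> (\<Union>p\<in>?P. ?C p)"
      then obtain p where p: "p \<in> ?P" and "(m, n) \<in> ?C p" unfolding i by (rule UN_E)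
      then obtain k l where kl: "m = 5 * k + fst p" "n = 5 * l + snd p" by (auto simp del: insert_iff)
      have "snd p = fst p \<or> snd p = - fst p" using p by auto
      hence "m - n = 5 * (k - l) \<or> m + n = 5 * (k + l)" unfolding kl by auto
      thus "5 dvd m - n \<or> 5 dvd m + n" by (metis dvd_triv_left)
    qed
    finally show "i \<in> (\<Union>p\<in>?P. ?C p) \<longleftrightarrow> i \<in> {i. 5 dvd e i}" by simp
  qed
  finally have "(\<Sum>\<^sub>\<infinity>i\<in>{i. 5 dvd e i}. q ^ (e i div 5)) = (\<Sum>p\<in>?P. ?w p)"
    by (rule infsumI)
  thus ?thesis unfolding T 2 by (simp add: mult.commute)
qed

section \<open>Values at \<open>q = 0\<close> and the final bilinear algebra\<close>

lemma RR_at_0: "RR_G 0 = 1" "RR_H 0 = 1"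
proof -
  have "(\<lambda>n. 0 ^ n\<^sup>2 / qpoch 0 0 n) sums (\<Sum>n\<in>{0}. 0 ^ n\<^sup>2 / qpoch 0 0 n)"
    by (rule sums_finite) auto
  thus "RR_G 0 = 1" by (simp add: RR_G_def sums_iff)
  have "(\<lambda>n. 0 ^ (n * (n + 1)) / qpoch 0 0 n) sums (\<Sum>n\<in>{0}. 0 ^ (n * (n + 1)) / qpoch 0 0 n)"
    by (rule sums_finite) auto
  thus "RR_H 0 = 1" by (simp add: RR_H_def sums_iff)
qed

lemma euler_E_at_0: "euler_E 0 = 1"
  by (simp add: euler_E_def qpoch_inf_def)

text \<open>Here \<open>G, H, K, L\<close> are the Rogers-Ramanujan functions at \<open>q^r\<close>
  and \<open>q^s\<close>, primes denote \<open>q^(4 r)\<close> and \<open>q^(4 s)\<close>, and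
  \<open>R, S, T, T'\<close> are \<open>q^r, q^s, q^t, q^(4 t)\<close>. The sides differ by a
  multiple of \<open>R S - T T'\<close>, which vanishes as \<open>r + s = 5 t\<close>.\<close>

lemma combine_plus:
  fixes E F :: "'a :: comm_ring_1"
  assumes "R * S = T * T'"
  shows "2 * (E * G * G' + R * (E * H * H')) * (F * K * K' + S * (F * L * L'))
      + (2 * ((E * G * G' - R * (E * H * H')) * (F * K * K' - S * (F * L * L')))
         + 4 * (T * (E * H * G' * (F * L * K'))) + 4 * (T' * (E * G * H' * (F * K * L'))))
    = 4 * E * F * (G * K + T * H * L) * (G' * K' + T' * H' * L')" (is "?l = ?r")
proof -
  have "?l - ?r = 4 * (R * S - T * T') * (E * F * H * H' * L * L')"
    by (simp add: algebra_simps)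
  thus ?thesis using assms by simp
qed

text \<open>With \<open>a = q^(s - t)\<close> and \<open>b = q^(t - r)\<close> the powers
  \<open>T, T', S\<close> become \<open>R b, R a, R a b\<close>, after which the claim is a
  polynomial identity.\<close>

lemma combine_minus:
  fixes E F :: "'a :: comm_ring_1"
  assumes "R * b = T" "R * a = T'" "S = T * a"
  shows "2 * (E * G * G' + R * (E * H * H')) * (F * K * K' + S * (F * L * L'))
      - (2 * ((E * G * G' - R * (E * H * H')) * (F * K * K' - S * (F * L * L')))
         + 4 * (T * (E * H * G' * (F * L * K'))) + 4 * (T' * (E * G * H' * (F * K * L'))))
    = 4 * R * E * F * (H * K' - a * G * L') * (H' * K - b * G' * L)"
  unfolding assms(3) assms(1)[symmetric] assms(2)[symmetric] by (simp add: algebra_simps)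

text \<open>The hypothesis on \<open>r\<close> and the congruence together exclude that 5 divides
  \<open>r\<close> or \<open>s\<close>; hence the mixed values \<open>U(r, 4 s)\<close> and
  \<open>U(4 r, s)\<close> fall under the second case of \<open>U\<close> only.\<close>

theorem theorem1p2:
  fixes r s :: nat and q :: complex
  assumes "r > 0" and "s > 0"
    and "[r + s = 0] (mod 5)"
    and "\<not> 5 dvd r"
    and "norm q < 1"
  shows "2 * ramanujan_phi (q ^ r) * ramanujan_phi (q ^ s)
           + T5 (\<lambda>x. ramanujan_phi (x ^ r) * ramanujan_phi (x ^ s)) q
         = 4 * euler_E (q ^ (2 * r)) * euler_E (q ^ (2 * s)) * RR_U r s q * RR_U (4 * r) (4 * s) q
       \<and> 2 * ramanujan_phi (q ^ r) * ramanujan_phi (q ^ s)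
           - T5 (\<lambda>x. ramanujan_phi (x ^ r) * ramanujan_phi (x ^ s)) q
         = 4 * q ^ r * euler_E (q ^ (2 * r)) * euler_E (q ^ (2 * s)) * RR_U r (4 * s) q * RR_U (4 * r) s q"
proof -
  obtain t where rs: "r + s = 5 * t" using assms(3) by (auto simp: cong_0_iff)
  have "t > 0" using rs assms(1) by linarith
  have ns: "\<not> 5 dvd s" using assms(4) rs by presburger
  have c1: "[s + r = 0] (mod 5)" "[4 * s + 4 * r = 0] (mod 5)" and d1: "(s + r) div 5 = t" "(4 * s + 4 * r) div 5 = 4 * t"
    using rs by (simp_all add: cong_0_iff add.commute[of s] add_mult_distrib2[symmetric])
  have U1: "RR_U r s q = RR_G (q ^ r) * RR_G (q ^ s) + q ^ t * RR_H (q ^ r) * RR_H (q ^ s)"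
    unfolding RR_U_def using c1(1) d1(1) by simp
  have U2: "RR_U (4 * r) (4 * s) q = RR_G (q ^ (4 * r)) * RR_G (q ^ (4 * s)) + q ^ (4 * t) * RR_H (q ^ (4 * r)) * RR_H (q ^ (4 * s))"
    unfolding RR_U_def using c1(2) d1(2) by simp
  show ?thesis
  proof (cases "q = 0")
    case True
    \<comment> \<open>At 0 both parts of \<open>T5\<close> contribute the constant coefficient 1.
      Both sides of the first identity are then 4 and, by the factor \<open>q^r\<close>, those of
      the second are 0.\<close>
    have "T5 (\<lambda>x. ramanujan_phi (x ^ r) * ramanujan_phi (x ^ s)) 0 = 2"
      using assms(1,2)
      by (simp add: T5_def T5_series_def eval_fps_at_0 fps_expansion_def ramanujan_phi_at_0 power_0_left)
    thus ?thesis unfolding U1 U2 using True assms(1,2) \<open>t > 0\<close>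
      by (simp add: ramanujan_phi_at_0 euler_E_at_0 RR_at_0 power_0_left)
  next
    case False
    \<comment> \<open>\<open>4 s - r = 5 s - (r + s)\<close>, and likewise
      \<open>s - 4 r = (r + s) - 5 r\<close>.\<close>
    have e3: "int (4 * s) - int r = 5 * (int s - int t)" using arg_cong[OF rs, of int] by simp
    have e4: "int s - int (4 * r) = 5 * (int t - int r)" using arg_cong[OF rs, of int] by simp
    \<comment> \<open>\<open>4 s + r = 5 t + 3 s\<close> and \<open>s + 4 r = 5 t + 3 r\<close>, so
      the first case of \<open>U\<close> does not apply.\<close>
    have "\<not> 5 dvd 4 * s + r" "\<not> 5 dvd s + 4 * r"
      using rs assms(4) ns by presburger+
    hence c2: "\<not> [4 * s + r = 0] (mod 5)" "\<not> [s + 4 * r = 0] (mod 5)" by (simp_all add: cong_0_iff)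
    have U3: "RR_U r (4 * s) q = RR_H (q ^ r) * RR_G (q ^ (4 * s)) - q powi (int s - int t) * RR_G (q ^ r) * RR_H (q ^ (4 * s))"
      unfolding RR_U_def e3 using c2(1) by (simp add: cong_0_iff)
    have U4: "RR_U (4 * r) s q = RR_H (q ^ (4 * r)) * RR_G (q ^ s) - q powi (int t - int r) * RR_G (q ^ (4 * r)) * RR_H (q ^ s)"
      unfolding RR_U_def e4 using c2(2) by (simp add: cong_0_iff)
    have id: "ramanujan_phi (q ^ k) = euler_E (q ^ (2 * k)) * RR_G (q ^ k) * RR_G (q ^ (4 * k)) + q ^ k * (euler_E (q ^ (2 * k)) * RR_H (q ^ k) * RR_H (q ^ (4 * k)))"
      "theta 1 10 5 (q ^ k) = euler_E (q ^ (2 * k)) * RR_G (q ^ k) * RR_G (q ^ (4 * k)) - q ^ k * (euler_E (q ^ (2 * k)) * RR_H (q ^ k) * RR_H (q ^ (4 * k)))"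
      "theta 1 10 7 (q ^ k) = euler_E (q ^ (2 * k)) * RR_H (q ^ k) * RR_G (q ^ (4 * k))"
      "theta 1 10 9 (q ^ k) = euler_E (q ^ (2 * k)) * RR_G (q ^ k) * RR_H (q ^ (4 * k))"
      if "k > 0" for k
    proof -
      have k: "norm (q ^ k) < 1" "q ^ k \<noteq> 0" using norm_power_less_1[OF assms(5) that] False by auto
      have p: "q ^ (2 * k) = (q ^ k) ^ 2" "q ^ (4 * k) = (q ^ k) ^ 4"
        by (metis power_mult mult.commute)+
      show "ramanujan_phi (q ^ k) = euler_E (q ^ (2 * k)) * RR_G (q ^ k) * RR_G (q ^ (4 * k)) + q ^ k * (euler_E (q ^ (2 * k)) * RR_H (q ^ k) * RR_H (q ^ (4 * k)))"
        unfolding p by (rule ramanujan_phi_RR[OF k])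
      show "theta 1 10 5 (q ^ k) = euler_E (q ^ (2 * k)) * RR_G (q ^ k) * RR_G (q ^ (4 * k)) - q ^ k * (euler_E (q ^ (2 * k)) * RR_H (q ^ k) * RR_H (q ^ (4 * k)))"
        unfolding p ramanujan_phi_5[OF k(1), symmetric] by (rule ramanujan_phi_5_RR[OF k])
      show "theta 1 10 7 (q ^ k) = euler_E (q ^ (2 * k)) * RR_H (q ^ k) * RR_G (q ^ (4 * k))"
        unfolding p by (rule euler_E_RR_H_G[OF k, symmetric])
      show "theta 1 10 9 (q ^ k) = euler_E (q ^ (2 * k)) * RR_G (q ^ k) * RR_H (q ^ (4 * k))"
        unfolding p by (rule euler_E_RR_G_H[OF k, symmetric])
    qed
    define a b where "a = q powi (int s - int t)" and "b = q powi (int t - int r)"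
    have ab: "q ^ r * b = q ^ t" "q ^ r * a = q ^ (4 * t)" "q ^ s = q ^ t * a"
    proof -
      have add: "q ^ k * q powi n = q powi (int k + n)" for k n using False by (simp add: power_int_add)
      show "q ^ r * b = q ^ t" unfolding b_def add by simp
      have "int r + (int s - int t) = int (4 * t)" using arg_cong[OF rs, of int] by simp
      thus "q ^ r * a = q ^ (4 * t)" unfolding a_def add by (simp only: power_int_of_nat)
      show "q ^ s = q ^ t * a" unfolding a_def add by simp
    qed
    note T = T5_phi_phi[OF assms(1,4,2,5) False rs]
    note I = id[OF assms(1)] id[OF assms(2)]
    show ?thesis
    proof
      have "q ^ r * q ^ s = q ^ t * q ^ (4 * t)" using rs by (simp flip: power_add)
      thus "2 * ramanujan_phi (q ^ r) * ramanujan_phi (q ^ s)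
           + T5 (\<lambda>x. ramanujan_phi (x ^ r) * ramanujan_phi (x ^ s)) q
         = 4 * euler_E (q ^ (2 * r)) * euler_E (q ^ (2 * s)) * RR_U r s q * RR_U (4 * r) (4 * s) q"
        unfolding T I U1 U2 by (rule combine_plus)
      show "2 * ramanujan_phi (q ^ r) * ramanujan_phi (q ^ s)
           - T5 (\<lambda>x. ramanujan_phi (x ^ r) * ramanujan_phi (x ^ s)) q
         = 4 * q ^ r * euler_E (q ^ (2 * r)) * euler_E (q ^ (2 * s)) * RR_U r (4 * s) q * RR_U (4 * r) s q"
        unfolding T I U3 U4 a_def[symmetric] b_def[symmetric] by (rule combine_minus[OF ab])
    qed
  qed
qed

end
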